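(* All coefficients $a_{ij}, b_{ij}, p_1,p_2,p_3,\mu$ below are real, and for each planar system $\dot x=P(x,y)$, $\dot y=Q(x,y)$ listed below the polynomials $P$ and $Q$ are assumed coprime in $\mathbb{R}[x,y]$ (except for the last system of part (c), system (C10), where this is not assumed). The following statements hold. **(a)** The system $$\text{(A1)}\quad \dot x=a_{10}x+a_{01}y,\quad \dot y=b_{10}x+b_{01}y$$ has a center at the origin if and only if $b_{01}=-a_{10}$ and $a_{10}b_{01}-a_{01}b_{10}>0$. For every integer $p>1$ the system $$\text{(A2)}\quad \dot x=a_{10}x,\quad \dot y=b_{p0}x^p+b_{01}y$$ has no centers. **(b)** The systems $$\text{(B1)}\quad \dot x=a_{20}x^2+a_{11}xy+a_{02}y^2,\quad \dot y=b_{20}x^2+b_{11}xy+b_{02}y^2,$$ $$\text{(B2)}\quad \dot x=a_{01}y,\quad \dot y=b_{20}x^2$$ have no centers. The system $$\text{(B3)}\quad \dot x=a_{20}x^2+a_{01}y,\quad \dot y=b_{30}x^3+b_{11}xy$$ has a center at the origin if and only if $a_{01}b_{30}\neq 0$ and $(2a_{20}+b_{11})^2+8(b_{30}a_{01}-b_{11}a_{20})<0$. **(c)** The system $$\text{(C1)}\quad \dot x=a_{30}x^3+a_{11}xy,\quad \dot y=b_{40}x^4+b_{21}x^2y+b_{02}y^2$$ has no centers. The system $$\text{(C2)}\quad \dot x=a_{30}x^3+a_{01}y,\quad \dot y=b_{50}x^5+b_{21}x^2y$$ has a center at the origin if and only if $a_{01}b_{50}\neq 0$, $(3a_{30}+b_{21})^2+12(b_{50}a_{01}-b_{21}a_{30})<0$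 and $3a_{30}+b_{21}=0$. The following systems have no centers: $$\text{(C3)}\quad \dot x=p_1x^3+p_2x^2y+p_3xy^2+\mu y^3,\quad \dot y=\mu x^3+p_1x^2y+p_2xy^2+p_3y^3,\qquad \mu\neq 0;$$ $$\text{(C4)}\quad \dot x=p_1x^3+(p_2+3\alpha)x^2y+(p_3-6\alpha)xy^2-6\alpha y^3,\quad \dot y=p_1x^2y+(p_2-3\alpha)xy^2+(p_3+6\alpha)y^3,\qquad \alpha=\pm1;$$ $$\text{(C5)}\quad \dot x=p_1x^3+p_2x^2y+(p_3+2)xy^2-4y^3,\quad \dot y=p_1x^2y+p_2xy^2+(p_3-2)y^3;$$ $$\text{(C6)}\quad \dot x=p_1x^3+(p_2-3\alpha)x^2y+p_3xy^2-6y^3,\quad \dot y=p_1x^2y+(p_2+3\alpha)xy^2+p_3y^3,\qquad \alpha=\pm1;$$ $$\text{(C7)}\quad \dot x=p_1x^3+p_2x^2y+p_3xy^2-\alpha y^3,\quad \dot y=p_1x^2y+p_2xy^2+p_3y^3,\qquad \alpha=\pm1;$$ $$\text{(C10)}\quad \dot x=x(p_1x^2+p_2xy+p_3y^2),\quad \dot y=y(p_1x^2+p_2xy+p_3y^2).$$ Each of the systems $$\text{(C8)}\quad \dot x=p_1x^3+(p_2-3\alpha\mu)x^2y+p_3xy^2-\alpha y^3,\quad \dot y=\alpha x^3+p_1x^2y+(p_2+3\alpha\mu)xy^2+p_3y^3,\qquad \alpha=\pm1,\ \mu>-\tfrac13,\ \mu\neq\tfrac13;$$ $$\text{(C9)}\quad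 \dot x=p_1x^3+(p_2-\alpha)x^2y+p_3xy^2-\alpha y^3,\quad \dot y=\alpha x^3+p_1x^2y+(p_2+\alpha)xy^2+p_3y^3,\qquad \alpha=\pm1$$ has a center if and only if $p_3=-p_1$. **(d)** The following systems have no centers: $$\text{(D1)}\quad \dot x=a_{40}x^4+a_{31}x^3y+a_{22}x^2y^2+a_{13}xy^3+a_{04}y^4,\quad \dot y=b_{40}x^4+b_{31}x^3y+b_{22}x^2y^2+b_{13}xy^3+b_{04}y^4;$$ $$\text{(D2)}\quad \dot x=a_{40}x^4+a_{21}x^2y+a_{02}y^2,\quad \dot y=b_{50}x^5+b_{31}x^3y+b_{12}xy^2;$$ $$\text{(D3)}\quad \dot x=a_{40}x^4+a_{11}xy,\quad \dot y=b_{60}x^6+b_{31}x^3y+b_{02}y^2;$$ $$\text{(D4)}\quad \dot x=a_{11}xy,\quad \dot y=b_{30}x^3+b_{02}y^2;$$ $$\text{(D5)}\quad \dot x=a_{01}y,\quad \dot y=b_{40}x^4.$$ The system $$\text{(D6)}\quad \dot x=a_{40}x^4+a_{01}y,\quad \dot y=b_{70}x^7+b_{31}x^3y$$ has a center at the origin if and only if $a_{01}b_{70}\neq 0$ and $(4a_{40}+b_{31})^2+16(b_{70}a_{01}-b_{31}a_{40})<0$.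
   Context: A singular point of a planar polynomial system $\dot x=P(x,y)$, $\dot y=Q(x,y)$ on $\mathbb{R}^2$ is a point $p\in\mathbb{R}^2$ with $P(p)=Q(p)=0$. A singular point $p$ is a center if there is a neighborhood of $p$ filled with (nonconstant) periodic orbits, with the unique exception of $p$ itself, i.e. every point of the neighborhood other than $p$ lies on a nonconstant periodic orbit. A system "has no centers" if none of its singular points in $\mathbb{R}^2$ is a center, and it "has a center" if some singular point is a center. The notation $\alpha=\pm1$ means that the assertion holds for each of the two values $\alpha=1$ and $\alpha=-1$. *)

theory Defs
  imports "HOL-Analysis.Analysis" "HOL-Computational_Algebra.Computational_Algebra"
begin

text \<open>
  The ring \<open>\<real>[x,y]\<close> is represented as \<open>\<real>[x][y]\<close>: a value of type \<^typ>\<open>real poly poly\<close> is a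
  polynomial in the outer variable \<open>y\<close> whose coefficients are polynomials in the inner
  variable \<open>x\<close>. Coprimality in \<open>\<real>[x,y]\<close> is then the library's \<^const>\<open>coprime\<close> at this type.
\<close>

definition cst :: "real \<Rightarrow> real poly poly"
  where "cst c = [:[:c:]:]"

definition xvar :: "real poly poly"  (\<open>\<^bold>x\<close>)
  where "\<^bold>x = [:[:0, 1:]:]"

definition yvar :: "real poly poly"  (\<open>\<^bold>y\<close>)
  where "\<^bold>y = [:0, 1:]"

definition eval2 :: "real poly poly \<Rightarrow> real \<times> real \<Rightarrow> real"
  where "eval2 P z = poly (poly P [:snd z:]) (fst z)"

lemma eval2_simps [simp]:
  "eval2 (cst c) z = c"
  "eval2 \<^bold>x z = fst z"
  "eval2 \<^bold>y z = snd z"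
  "eval2 (P + Q) z = eval2 P z + eval2 Q z"
  "eval2 (P - Q) z = eval2 P z - eval2 Q z"
  "eval2 (P * Q) z = eval2 P z * eval2 Q z"
  "eval2 (P ^ n) z = eval2 P z ^ n"
  by (simp_all add: eval2_def cst_def xvar_def yvar_def)

definition solution :: "real poly poly \<Rightarrow> real poly poly \<Rightarrow> (real \<Rightarrow> real \<times> real) \<Rightarrow> bool"
  where "solution P Q \<gamma> \<longleftrightarrow>
    (\<forall>t. (\<gamma> has_vector_derivative (eval2 P (\<gamma> t), eval2 Q (\<gamma> t))) (at t))"

definition on_periodic_orbit :: "real poly poly \<Rightarrow> real poly poly \<Rightarrow> real \<times> real \<Rightarrow> bool"
  where "on_periodic_orbit P Q q \<longleftrightarrow>
    (\<exists>\<gamma> T. solution P Q \<gamma> \<and> T > 0 \<and> (\<forall>t. \<gamma> (t + T) = \<gamma> t) \<and>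
      \<not> \<gamma> constant_on UNIV \<and> q \<in> range \<gamma>)"

definition singular_point :: "real poly poly \<Rightarrow> real poly poly \<Rightarrow> real \<times> real \<Rightarrow> bool"
  where "singular_point P Q p \<longleftrightarrow> eval2 P p = 0 \<and> eval2 Q p = 0"

definition is_center :: "real poly poly \<Rightarrow> real poly poly \<Rightarrow> real \<times> real \<Rightarrow> bool"
  where "is_center P Q p \<longleftrightarrow> singular_point P Q p \<and>
    (\<exists>U. open U \<and> p \<in> U \<and> (\<forall>q\<in>U - {p}. on_periodic_orbit P Q q))"

definition has_center :: "real poly poly \<Rightarrow> real poly poly \<Rightarrow> bool"
  where "has_center P Q \<longleftrightarrow> (\<exists>p. is_center P Q p)"

end

theory Submission
  imports Defs
begin

text \<open>
  All systems except (B2), (D4), (D5) are quasi-homogeneous with weights $(1,k)$; put $V = xQ - kyP$.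
  A zero $(1,c)$ of $V$ makes the curve $y = cx^k$ invariant, and $P(0,y) = 0$ does the same for the
  $y$-axis. On an invariant curve the system reduces to a scalar autonomous equation, which has no
  nonconstant periodic solution, so these curves exclude centers; in particular every center is at
  the origin and $V$ is definite. This settles the systems without centers.

  If $V$ is definite, then in the coordinates $x = \rho\cos\theta$, $y = \rho^k\sin\theta$ the orbits
  are obtained by one quadrature, and the origin is a center once $\ln\rho$ is a $2\pi$-periodic function
  of $\theta$. Periodicity follows from reversibility in (B3) and (D6), and from $V$ being a first
  integral in (A1) and (C2). Conversely $\dot V = V\,\mathrm{div}(P,Q)$, so a nonzero divergence makes $V^2$
  monotone in (A1) and (C2). In (C8) and (C9) one has $\dot V = 4V(p_1x^2 + p_2xy + p_3y^2)$, and the part of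
  the quadratic form orthogonal to $x^2+y^2$ can be integrated explicitly on the punctured plane; what
  remains is the Lyapunov derivative $\frac{1}{2}(p_1+p_3)(x^2+y^2)$.
\<close>

section \<open>Real analysis\<close>

text \<open>The fundamental theorem on open intervals is used with infinite endpoints, so that a
  single antiderivative serves the whole line.\<close>

lemma ex_antiderivative:
  fixes f :: "real \<Rightarrow> real"
  assumes "\<And>x. isCont f x"
  obtains F where "\<And>x. (F has_real_derivative f x) (at x)"
proof -
  have "\<exists>F. \<forall>x. (-\<infinity>::ereal) < ereal x \<longrightarrow> ereal x < \<infinity> \<longrightarrow> (F has_vector_derivative f x) (at x)"
    by (rule einterval_antiderivative) (use assms in auto)
  then show ?thesis
    using that by (auto simp: has_real_derivative_iff_has_vector_derivative)
qed

lemma deriv_zero_imp_constant: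
  fixes f f' :: "real \<Rightarrow> real"
  assumes "\<And>t. (f has_real_derivative f' t) (at t)" and "\<And>t. f' t = 0"
  shows "f t = f s"
  using DERIV_isconst_all[of f t s] assms by simp

text \<open>With the integrating factor, \<open>u t * exp (- A t)\<close> is constant. The intended
  use is invariance: if \<open>u\<close> is the equation of a curve evaluated along a solution and
  \<open>K\<close> is its cofactor, a solution meeting the curve once stays on it.\<close>

lemma zero_of_linear_ode:
  fixes u K :: "real \<Rightarrow> real"
  assumes u: "\<And>t. (u has_real_derivative K t * u t) (at t)"
    and K: "\<And>t. isCont K t" and "u t0 = 0"
  shows "u t = 0"
proof -
  obtain A where A: "\<And>t. (A has_real_derivative K t) (at t)"
    using ex_antiderivative[of K] K by blast
  have "((\<lambda>t. u t * exp (- A t)) has_real_derivative 0) (at t)" for t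
    by (rule derivative_eq_intros u A refl | simp add: algebra_simps)+
  then have "u t * exp (- A t) = u t0 * exp (- A t0)"
    using DERIV_isconst_all[of "\<lambda>t. u t * exp (- A t)"] by blast
  then show ?thesis using \<open>u t0 = 0\<close> by simp
qed

lemma periodic_shift:
  fixes f :: "real \<Rightarrow> 'a" and n :: nat
  assumes "\<And>t. f (t + T) = f t"
  shows "f (t + real n * T) = f t"
proof (induction n)
  case (Suc n)
  have "f (t + real (Suc n) * T) = f ((t + real n * T) + T)"
    by (simp add: algebra_simps)
  then show ?case using Suc assms by simp
qed simp

text \<open>Each value \<open>f t\<close> is bounded by a later value
  \<open>f (s + n T) = f s\<close>, so monotonicity makes \<open>f\<close> constant. This is how
  quantities that are monotone along solutions exclude periodic orbits.\<close>

lemma periodic_monotone_deriv_zero: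
  fixes f f' :: "real \<Rightarrow> real"
  assumes f: "\<And>t. (f has_real_derivative f' t) (at t)"
    and per: "\<And>t. f (t + T) = f t" and "T > 0" and pos: "\<And>t. f' t \<ge> 0"
  shows "f' t = 0"
proof -
  have mono: "f s \<le> f t" if "s \<le> t" for s t
    using DERIV_nonneg_imp_nondecreasing[OF that] f pos by blast
  have "f t \<le> f s" for s t
  proof -
    obtain n where "(t - s) / T \<le> real n" using real_arch_simple by blast
    then have "t \<le> s + real n * T" using \<open>T > 0\<close> by (simp add: field_simps)
    then have "f t \<le> f (s + real n * T)" by (rule mono)
    then show ?thesis using periodic_shift[of f T] per by simp
  qed
  then have "f = (\<lambda>_. f 0)" by (intro ext) (simp add: order_antisym)
  then have "(f has_real_derivative 0) (at t)" by (metis DERIV_const)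
  then show ?thesis using f DERIV_unique by blast
qed

text \<open>If $G' = g$ then $(G \circ x)' = g(x)^2$ along $x' = g(x)$, whatever the sign of $g$.\<close>
lemma scalar_periodic_stationary:
  fixes x g :: "real \<Rightarrow> real"
  assumes x: "\<And>t. (x has_real_derivative g (x t)) (at t)"
    and g: "\<And>s. isCont g s" and per: "\<And>t. x (t + T) = x t" and "T > 0"
  shows "g (x t) = 0"
proof -
  obtain G where G: "\<And>t. (G has_real_derivative g t) (at t)"
    using ex_antiderivative[of g] g by blast
  have "((\<lambda>t. G (x t)) has_real_derivative g (x t) * g (x t)) (at t)" for t
    using DERIV_chain2[OF G x] by simp
  then have "g (x t) * g (x t) = 0"
    by (rule periodic_monotone_deriv_zero) (use per \<open>T > 0\<close> in auto)
  then show ?thesis by simp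
qed

lemma odd_degree_imp_root:
  fixes p :: "real poly"
  assumes "odd (degree p)"
  shows "\<exists>x. poly p x = 0"
proof -
  have *: "\<exists>x. poly q x = 0" if q: "odd (degree q)" "lead_coeff q > 0" for q :: "real poly"
  proof -
    \<comment> \<open>For odd degree, \<open>r\<close> has the leading coefficient of
      \<open>q\<close>, and positivity of \<open>r\<close> far to the right is negativity of
      \<open>q\<close> far to the left.\<close>
    define r where "r = - (pcompose q [:0, -1:])"
    have "lead_coeff r = lead_coeff q"
      using q by (simp add: r_def lead_coeff_minus lead_coeff_comp)
    then obtain a where a: "\<And>x. x \<ge> a \<Longrightarrow> poly r x > 0"
      using poly_pinfty_gt_lc[of r] q by force
    obtain b where b: "\<And>x. x \<ge> b \<Longrightarrow> poly q x > 0"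
      using poly_pinfty_gt_lc[of q] q by force
    have "poly q (- max 1 a) < 0"
      using a[of "max 1 a"] by (simp add: r_def poly_pcompose)
    moreover have "poly q (max 1 b) > 0" using b by simp
    ultimately show ?thesis
      using poly_IVT_pos[of "- max 1 a" "max 1 b" q] by force
  qed
  consider "lead_coeff p > 0" | "lead_coeff (- p) > 0"
    using assms by (fastforce simp: lead_coeff_minus neq_iff)
  then show ?thesis
    using *[of p] *[of "- p"] assms by cases auto
qed

section \<open>Solutions and periodic orbits\<close>

lemma eval2_pCons: "eval2 (pCons a P) z = poly a (fst z) + snd z * eval2 P z"
  by (simp add: eval2_def)

lemma eval2_0 [simp]: "eval2 0 z = 0"
  by (simp add: eval2_def)

lemma isCont_eval2:
  assumes "isCont f t"
  shows "isCont (\<lambda>t. eval2 P (f t)) t"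
proof (induction P)
  case (pCons a P)
  then show ?case using assms
    unfolding eval2_pCons by (intro continuous_intros)
qed simp

lemma solution_derivs:
  assumes "solution P Q \<gamma>"
  shows "((\<lambda>t. fst (\<gamma> t)) has_real_derivative eval2 P (\<gamma> t)) (at t)"
    and "((\<lambda>t. snd (\<gamma> t)) has_real_derivative eval2 Q (\<gamma> t)) (at t)"
proof -
  have d: "(\<gamma> has_derivative (\<lambda>h. h *\<^sub>R (eval2 P (\<gamma> t), eval2 Q (\<gamma> t)))) (at t)"
    using assms by (simp add: solution_def has_vector_derivative_def)
  show "((\<lambda>t. fst (\<gamma> t)) has_real_derivative eval2 P (\<gamma> t)) (at t)"
    using has_derivative_fst[OF d] by (simp add: has_field_derivative_def mult.commute[of _ "eval2 P (\<gamma> t)"])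
  show "((\<lambda>t. snd (\<gamma> t)) has_real_derivative eval2 Q (\<gamma> t)) (at t)"
    using has_derivative_snd[OF d] by (simp add: has_field_derivative_def mult.commute[of _ "eval2 Q (\<gamma> t)"])
qed

lemma solution_isCont: "solution P Q \<gamma> \<Longrightarrow> isCont \<gamma> t"
  unfolding solution_def using has_vector_derivative_continuous by blast

lemma solution_stationary_constant:
  assumes "solution P Q \<gamma>" and "\<And>t. eval2 P (\<gamma> t) = 0" and "\<And>t. eval2 Q (\<gamma> t) = 0"
  shows "\<gamma> constant_on UNIV"
proof -
  have "fst (\<gamma> t) = fst (\<gamma> 0)" for t
    by (rule deriv_zero_imp_constant[OF solution_derivs(1)[OF assms(1)] assms(2)])
  moreover have "snd (\<gamma> t) = snd (\<gamma> 0)" for t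
    by (rule deriv_zero_imp_constant[OF solution_derivs(2)[OF assms(1)] assms(3)])
  ultimately show ?thesis
    unfolding constant_on_def by (metis prod_eqI)
qed

text \<open>A solution along which the field vanishes is constant, whereas a periodic orbit has to
  be nonconstant. The premise supplies coordinate derivatives and continuity, so each application
  only has to show that an arbitrary periodic solution through \<open>q\<close> is
  stationary.\<close>

lemma not_on_periodic_orbitI:
  assumes "\<And>\<gamma> T t0. solution P Q \<gamma> \<Longrightarrow> T > 0 \<Longrightarrow> (\<And>t. \<gamma> (t + T) = \<gamma> t) \<Longrightarrow> \<gamma> t0 = q \<Longrightarrow>
    (\<And>t. isCont \<gamma> t) \<Longrightarrow>
    (\<And>t. ((\<lambda>t. fst (\<gamma> t)) has_real_derivative eval2 P (\<gamma> t)) (at t)) \<Longrightarrow>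
    (\<And>t. ((\<lambda>t. snd (\<gamma> t)) has_real_derivative eval2 Q (\<gamma> t)) (at t)) \<Longrightarrow>
    \<forall>t. eval2 P (\<gamma> t) = 0 \<and> eval2 Q (\<gamma> t) = 0"
  shows "\<not> on_periodic_orbit P Q q"
proof
  assume "on_periodic_orbit P Q q"
  then obtain \<gamma> T t0 where g: "solution P Q \<gamma>" "T > 0" "\<And>t. \<gamma> (t + T) = \<gamma> t" "\<gamma> t0 = q"
    "\<not> \<gamma> constant_on UNIV" unfolding on_periodic_orbit_def by blast
  have "\<forall>t. eval2 P (\<gamma> t) = 0 \<and> eval2 Q (\<gamma> t) = 0"
    by (rule assms) (use g solution_derivs[OF g(1)] solution_isCont[OF g(1)] in blast)+
  then show False
    using solution_stationary_constant[OF g(1)] g(5) by simp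
qed

lemma not_center_if_frequently:
  assumes "\<And>U. open U \<Longrightarrow> p \<in> U \<Longrightarrow> \<exists>q\<in>U - {p}. \<not> on_periodic_orbit P Q q"
  shows "\<not> is_center P Q p"
  using assms unfolding is_center_def by blast

text \<open>Singletons are not open in the plane, so every neighbourhood of a center contains a
  second point, which would lie on a periodic orbit.\<close>

lemma no_center_if_no_periodic_orbit:
  assumes "\<And>q. \<not> on_periodic_orbit P Q q"
  shows "\<not> has_center P Q"
  unfolding has_center_def
proof (rule notI, erule exE)
  fix p assume "is_center P Q p"
  then obtain U where U: "open U" "p \<in> U" "\<And>q. q \<in> U - {p} \<Longrightarrow> on_periodic_orbit P Q q"
    unfolding is_center_def by auto
  have "U \<noteq> {p}" using U(1) not_open_singleton by metis
  then obtain q where "q \<in> U - {p}" using U(2) by auto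
  then show False using U(3)[of q] assms[of q] by simp
qed

text \<open>Continuity at \<open>s\<close> brings points \<open>c r\<close> with
  \<open>r > s\<close> into every neighbourhood of \<open>p\<close>. Thus one arc leaving
  \<open>p\<close> and avoiding all periodic orbits is enough.\<close>

lemma not_center_curve:
  fixes c :: "real \<Rightarrow> real \<times> real"
  assumes "isCont c s" "c s = p" "\<And>r. r > s \<Longrightarrow> c r \<noteq> p" "\<And>r. r > s \<Longrightarrow> \<not> on_periodic_orbit P Q (c r)"
  shows "\<not> is_center P Q p"
proof (rule not_center_if_frequently)
  fix U assume U: "open U" "p \<in> U"
  have "(c \<longlongrightarrow> p) (at_right s)"
    using assms(1,2) by (metis isCont_def filterlim_at_split)
  then have "eventually (\<lambda>r. c r \<in> U) (at_right s)"
    using U topological_tendstoD by blast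
  moreover have "eventually (\<lambda>r. r > s) (at_right s)" by (simp add: eventually_at_right_less)
  ultimately have "eventually (\<lambda>r. r > s \<and> c r \<in> U) (at_right s)" by eventually_elim simp
  then obtain r where "r > s" "c r \<in> U"
    using eventually_happens' trivial_limit_at_right_real by blast
  then show "\<exists>q\<in>U - {p}. \<not> on_periodic_orbit P Q q" using assms by blast
qed

section \<open>Invariant curves\<close>

lemma y_axis_not_periodic:
  assumes "xvar dvd P"
  shows "\<not> on_periodic_orbit P Q (0, y)"
proof (rule not_on_periodic_orbitI, rule allI)
  fix \<gamma> T t0 t
  assume s: "solution P Q \<gamma>" "T > 0" "\<And>t. \<gamma> (t + T) = \<gamma> t" "\<gamma> t0 = (0, y)" "\<And>t. isCont \<gamma> t"
    and dx: "\<And>t. ((\<lambda>t. fst (\<gamma> t)) has_real_derivative eval2 P (\<gamma> t)) (at t)"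
    and dy: "\<And>t. ((\<lambda>t. snd (\<gamma> t)) has_real_derivative eval2 Q (\<gamma> t)) (at t)"
  obtain K where K: "P = xvar * K" using assms by blast
  \<comment> \<open>The first coordinate satisfies x' = K x and vanishes at \<open>t0\<close>, so
    the solution stays on the axis and only a scalar equation for y remains.\<close>
  have x0: "fst (\<gamma> t) = 0" for t
    by (rule zero_of_linear_ode[where K = "\<lambda>t. eval2 K (\<gamma> t)" and ?t0.0 = t0])
      (use dx s K in \<open>auto simp: mult.commute intro!: isCont_eval2\<close>)
  then have g: "\<gamma> t = (0, snd (\<gamma> t))" for t by (simp add: prod_eq_iff)
  then have Qg: "eval2 Q (\<gamma> t) = eval2 Q (0, snd (\<gamma> t))" for t by metis
  have "eval2 Q (0, snd (\<gamma> t)) = 0"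
    by (rule scalar_periodic_stationary[where g = "\<lambda>y. eval2 Q (0, y)" and T = T])
      (use dy[unfolded Qg] s(2,3) in \<open>auto intro!: isCont_eval2 continuous_intros\<close>)
  then show "eval2 P (\<gamma> t) = 0 \<and> eval2 Q (\<gamma> t) = 0"
    using K x0 Qg by simp
qed

section \<open>Quasi-homogeneous fields and their invariant curves y = c x^k\<close>

text \<open>Quasi-homogeneity with weights $(1,k)$ and weight degree $m+1$.\<close>
definition qhom :: "nat \<Rightarrow> nat \<Rightarrow> real poly poly \<Rightarrow> real poly poly \<Rightarrow> bool"
  where "qhom k m P Q \<longleftrightarrow> (\<forall>l x y.
    eval2 P (l * x, l ^ k * y) = l ^ (m + 1) * eval2 P (x, y) \<and>
    eval2 Q (l * x, l ^ k * y) = l ^ (m + k) * eval2 Q (x, y))"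

text \<open>Every point of the curve, including the one with x = 0, is the point (1, c) scaled by
  the factor \<open>x\<close>.\<close>

lemma qhom_curve:
  assumes "qhom k m P Q"
  shows "eval2 P (x, c * x ^ k) = x ^ (m + 1) * eval2 P (1, c)"
    and "eval2 Q (x, c * x ^ k) = x ^ (m + k) * eval2 Q (1, c)"
  using assms unfolding qhom_def by (metis mult.commute mult_1)+

lemma invariant_curve_not_periodic:
  assumes q: "qhom k m P Q" and "k > 0"
    and c: "eval2 Q (1, c) = real k * c * eval2 P (1, c)"
  shows "\<not> on_periodic_orbit P Q (x0, c * x0 ^ k)"
proof (rule not_on_periodic_orbitI, rule allI)
  fix \<gamma> T t0 t
  assume s: "solution P Q \<gamma>" "T > 0" "\<And>t. \<gamma> (t + T) = \<gamma> t" "\<gamma> t0 = (x0, c * x0 ^ k)" "\<And>t. isCont \<gamma> t"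
    and dx: "\<And>t. ((\<lambda>t. fst (\<gamma> t)) has_real_derivative eval2 P (\<gamma> t)) (at t)"
    and dy: "\<And>t. ((\<lambda>t. snd (\<gamma> t)) has_real_derivative eval2 Q (\<gamma> t)) (at t)"
  \<comment> \<open>\<open>R\<close> is the derivative of y - c x^k along the field; the condition
    on \<open>c\<close> makes it vanish on the curve.\<close>
  define R where "R = Q - cst (c * real k) * xvar ^ (k - 1) * P"
  have R0: "eval2 R (x, c * x ^ k) = 0" for x
  proof -
    have "eval2 R (x, c * x ^ k) = x ^ (m + k) * (eval2 Q (1, c) - (c * real k) * eval2 P (1, c))"
      using \<open>k > 0\<close> power_add[of x "k - 1" "m + 1"]
      by (simp add: R_def qhom_curve[OF q] right_diff_distrib ac_simps)
    then show ?thesis using c by simp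
  qed
  \<comment> \<open>As a polynomial in y over the ring of polynomials in x, \<open>R\<close> has the
    root c x^k, since the substituted polynomial vanishes at every real x. The factor theorem then
    yields the cofactor \<open>K\<close>.\<close>
  have "poly (poly R (monom c k)) x = eval2 R (x, c * x ^ k)" for x
    unfolding eval2_def by (induction R) (simp_all add: poly_monom)
  then have "poly R (monom c k) = 0"
    using R0 by (metis poly_all_0_iff_0)
  then obtain K where K: "R = [:- monom c k, 1:] * K"
    unfolding poly_eq_0_iff_dvd by blast
  have RK: "eval2 R z = (snd z - c * fst z ^ k) * eval2 K z" for z
    unfolding K by (simp add: eval2_def poly_monom algebra_simps)
  have "snd (\<gamma> t) - c * fst (\<gamma> t) ^ k = 0" for t
  proof (rule zero_of_linear_ode[where u = "\<lambda>t. snd (\<gamma> t) - c * fst (\<gamma> t) ^ k"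
        and K = "\<lambda>t. eval2 K (\<gamma> t)" and ?t0.0 = t0])
    fix t
    have "((\<lambda>t. snd (\<gamma> t) - c * fst (\<gamma> t) ^ k) has_real_derivative eval2 R (\<gamma> t)) (at t)"
      by (rule derivative_eq_intros dx dy refl | simp add: R_def)+
    then show "((\<lambda>t. snd (\<gamma> t) - c * fst (\<gamma> t) ^ k) has_real_derivative
        eval2 K (\<gamma> t) * (snd (\<gamma> t) - c * fst (\<gamma> t) ^ k)) (at t)"
      by (simp add: RK mult.commute)
  qed (use s in \<open>auto intro: isCont_eval2\<close>)
  then have g: "\<gamma> t = (fst (\<gamma> t), c * fst (\<gamma> t) ^ k)" for t by (simp add: prod_eq_iff)
  then have Pg: "eval2 P (\<gamma> t) = eval2 P (fst (\<gamma> t), c * fst (\<gamma> t) ^ k)"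
    and Qg: "eval2 Q (\<gamma> t) = eval2 Q (fst (\<gamma> t), c * fst (\<gamma> t) ^ k)" for t by metis+
  have P: "eval2 P (fst (\<gamma> t), c * fst (\<gamma> t) ^ k) = 0"
    by (rule scalar_periodic_stationary[where g = "\<lambda>x. eval2 P (x, c * x ^ k)" and T = T])
      (use dx[unfolded Pg] s(2,3) in \<open>auto intro!: isCont_eval2 continuous_intros\<close>)
  \<comment> \<open>Either the solution is at the origin at time \<open>t\<close>, or P(1, c) = 0
    and hence Q(1, c) = 0 by the condition on \<open>c\<close>.\<close>
  then have "fst (\<gamma> t) = 0 \<or> eval2 P (1, c) = 0"
    by (auto simp: qhom_curve(1)[OF q])
  then have "eval2 Q (fst (\<gamma> t), c * fst (\<gamma> t) ^ k) = 0"
    using c \<open>k > 0\<close> by (auto simp: qhom_curve(2)[OF q])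
  then show "eval2 P (\<gamma> t) = 0 \<and> eval2 Q (\<gamma> t) = 0"
    using P Pg Qg by simp
qed

text \<open>A singular point with x0 \<noteq> 0 lies on a curve y = c x^k with P(1, c) = Q(1, c) =
  0, which is therefore invariant. A singular point with x0 = 0 and y0 \<noteq> 0 forces a = 0,
  because P(0, y) = a y^(i+1), so the y-axis is invariant. In both cases points of the curve near
  \<open>p\<close> lie on no periodic orbit.\<close>

lemma qhom_no_center_away_from_origin:
  assumes q: "qhom k m P Q" and "k > 0" and P: "P = xvar * P1 + cst a * yvar ^ Suc i" and "p \<noteq> (0, 0)"
  shows "\<not> is_center P Q p"
proof
  assume ctr: "is_center P Q p"
  obtain x0 y0 where p: "p = (x0, y0)" by fastforce
  have sing: "eval2 P (x0, y0) = 0" "eval2 Q (x0, y0) = 0"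
    using ctr by (auto simp: is_center_def singular_point_def p)
  show False
  proof (cases "x0 = 0")
    case True
    then have "a = 0" using sing \<open>p \<noteq> (0, 0)\<close> by (simp add: P p)
    then have "xvar dvd P" by (simp add: P cst_def)
    then have "\<not> is_center P Q p"
      by (intro not_center_curve[where c = "\<lambda>r. (0, r)" and s = y0])
        (auto simp: p True y_axis_not_periodic intro!: continuous_intros)
    then show False using ctr by simp
  next
    case False
    define c where "c = y0 / x0 ^ k"
    have y0: "y0 = c * x0 ^ k" using False by (simp add: c_def)
    have "eval2 Q (1, c) = real k * c * eval2 P (1, c)"
      using sing False by (simp add: y0 qhom_curve[OF q])
    note np = invariant_curve_not_periodic[OF q \<open>k > 0\<close> this]
    have "\<not> is_center P Q p"
      by (rule not_center_curve[where c = "\<lambda>r. (r, c * r ^ k)" and s = x0])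
        (auto simp: p y0 np intro!: continuous_intros)
    then show False using ctr by simp
  qed
qed

text \<open>If a = 0 the y-axis is an invariant curve through the origin, and if V(1, c) = 0 the
  curve y = c x^k is one; either contradicts a center there.\<close>

lemma qhom_center_imp:
  assumes q: "qhom k m P Q" and "k > 0" and P: "P = xvar * P1 + cst a * yvar ^ Suc i"
    and ctr: "is_center P Q p"
  shows "p = (0, 0)" and "a \<noteq> 0" and "eval2 Q (1, c) \<noteq> real k * c * eval2 P (1, c)"
proof -
  show p: "p = (0, 0)" using qhom_no_center_away_from_origin[OF q \<open>k > 0\<close> P] ctr by blast
  show "a \<noteq> 0"
  proof
    assume "a = 0"
    then have "xvar dvd P" by (simp add: P cst_def)
    then have "\<not> is_center P Q p"
      by (intro not_center_curve[where c = "\<lambda>r. (0, r)" and s = 0])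
        (auto simp: p y_axis_not_periodic intro!: continuous_intros)
    then show False using ctr by simp
  qed
  show "eval2 Q (1, c) \<noteq> real k * c * eval2 P (1, c)"
  proof
    assume "eval2 Q (1, c) = real k * c * eval2 P (1, c)"
    note np = invariant_curve_not_periodic[OF q \<open>k > 0\<close> this]
    have "\<not> is_center P Q p"
      by (rule not_center_curve[where c = "\<lambda>r. (r, c * r ^ k)" and s = 0])
        (use \<open>k > 0\<close> in \<open>auto simp: p np intro!: continuous_intros\<close>)
    then show False using ctr by simp
  qed
qed

section \<open>Construction of periodic orbits\<close>

text \<open>The antiderivative \<open>G\<close> of the speed factor \<open>g\<close> measures
  elapsed time and is an increasing bijection of the line. Composing \<open>c\<close> with the
  inverse of \<open>G\<close> gives a solution, whose period \<open>T\<close> is the time needed for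
  one turn.\<close>

lemma reparametrised_periodic_orbit_pos:
  fixes c :: "real \<Rightarrow> real \<times> real" and g :: "real \<Rightarrow> real"
  assumes c: "\<And>s. (c has_vector_derivative g s *\<^sub>R (eval2 P (c s), eval2 Q (c s))) (at s)"
    and g: "\<And>s. isCont g s" and pos: "\<And>s. g s > 0" and gper: "\<And>s. g (s + S) = g s"
    and cper: "\<And>s. c (s + S) = c s" and "S > 0" and nc: "\<not> c constant_on UNIV"
  shows "on_periodic_orbit P Q (c s)"
proof -
  obtain G where G: "\<And>t. (G has_real_derivative g t) (at t)"
    using ex_antiderivative[of g] g by blast
  have mono: "G s < G t" if "s < t" for s t
    using DERIV_pos_imp_increasing[OF that] G pos by blast
  have inj: "s = t" if "G s = G t" for s t
    using mono[of s t] mono[of t s] that by force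
  have contG: "isCont G t" for t using G DERIV_isCont by blast
  define T where "T = G S - G 0"
  have "T > 0" unfolding T_def using mono[OF \<open>S > 0\<close>] by simp
  have "((\<lambda>t. G (t + S) - G t) has_real_derivative 0) (at t)" for t
    by (rule derivative_eq_intros DERIV_chain2[where f = G, OF G] G refl | simp add: gper)+
  then have "G (t + S) - G t = G (0 + S) - G 0" for t
    using DERIV_isconst_all[of "\<lambda>t. G (t + S) - G t"] by blast
  then have Gper: "G (t + S) = G t + T" for t
    unfolding T_def by (metis add_0 diff_add_cancel add.commute)
  have Gn: "G (t + real n * S) = G t + real n * T" for t and n :: nat
  proof (induction n)
    case (Suc n)
    then show ?case using Gper[of "t + real n * S"] by (simp add: algebra_simps)
  qed simp
  \<comment> \<open>\<open>G\<close> grows by \<open>T > 0\<close> over each interval of length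
    \<open>S\<close>, so it is unbounded in both directions.\<close>
  have surj: "\<exists>t. G t = y" for y
  proof -
    obtain n :: nat where "\<bar>y - G 0\<bar> / T \<le> real n" using real_arch_simple by blast
    then have n: "\<bar>y - G 0\<bar> \<le> real n * T" using \<open>T > 0\<close> by (simp add: field_simps)
    have "y \<le> G (0 + real n * S)" using n Gn[of 0 n] by linarith
    moreover have "G (- (real n * S)) + real n * T = G 0"
      using Gn[of "- (real n * S)" n] by simp
    then have "G (- (real n * S)) \<le> y" using n by linarith
    ultimately show ?thesis
      using IVT[of G "- (real n * S)" y "0 + real n * S"] contG \<open>S > 0\<close> by auto
  qed
  define H where "H = inv G"
  have GH: "G (H t) = t" for t unfolding H_def using surj by (metis f_inv_into_f rangeI)
  have HG: "H (G t) = t" for t using inj GH by blast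
  have contH: "isCont H t" for t
    using isCont_inverse_function[of 1 "H t" H G] HG contG GH by simp
  have H: "(H has_real_derivative inverse (g (H t))) (at t)" for t
    by (rule DERIV_inverse_function[where f = G and a = "t - 1" and b = "t + 1"])
      (use G pos[of "H t"] GH contH in auto)
  have Hper: "H (t + T) = H t + S" for t
    by (rule inj) (simp add: GH Gper)
  define \<gamma> where "\<gamma> = (\<lambda>t. c (H t))"
  have "solution P Q \<gamma>"
    unfolding solution_def
  proof
    fix t
    have "((c \<circ> H) has_vector_derivative inverse (g (H t)) *\<^sub>R g (H t) *\<^sub>R (eval2 P (c (H t)), eval2 Q (c (H t)))) (at t)"
      by (rule vector_diff_chain_at)
        (use H c in \<open>simp_all add: has_real_derivative_iff_has_vector_derivative[symmetric]\<close>)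
    then show "(\<gamma> has_vector_derivative (eval2 P (\<gamma> t), eval2 Q (\<gamma> t))) (at t)"
      using less_imp_neq[OF pos[of "H t"]] by (simp add: \<gamma>_def o_def flip: mult.assoc)
  qed
  moreover have "\<gamma> (t + T) = \<gamma> t" for t by (simp add: \<gamma>_def Hper cper)
  moreover have cg: "c s = \<gamma> (G s)" for s by (simp add: \<gamma>_def HG)
  moreover have "\<not> \<gamma> constant_on UNIV"
    using nc unfolding constant_on_def by (simp add: cg) metis
  ultimately show ?thesis
    unfolding on_periodic_orbit_def using \<open>T > 0\<close> by (metis rangeI)
qed

text \<open>A continuous factor without zeros has constant sign; if it is negative, the curve run
  backwards has the positive factor \<open>- g (- s)\<close>.\<close>

lemma reparametrised_periodic_orbit:
  fixes c :: "real \<Rightarrow> real \<times> real" and g :: "real \<Rightarrow> real"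
  assumes c: "\<And>s. (c has_vector_derivative g s *\<^sub>R (eval2 P (c s), eval2 Q (c s))) (at s)"
    and g: "\<And>s. isCont g s" and nz: "\<And>s. g s \<noteq> 0" and gper: "\<And>s. g (s + S) = g s"
    and cper: "\<And>s. c (s + S) = c s" and "S > 0" and nc: "\<not> c constant_on UNIV"
  shows "on_periodic_orbit P Q (c s)"
proof -
  have "(\<forall>s. g s > 0) \<or> (\<forall>s. g s < 0)"
  proof (rule ccontr)
    assume "\<not> ?thesis"
    then obtain a b where ab: "g a < 0" "g b > 0" using nz by (metis neqE)
    have "\<exists>s. g s = 0"
      by (cases "a \<le> b") (use IVT[of g a 0 b] IVT2[of g a 0 b] ab g in \<open>force\<close>)+
    then show False using nz by blast
  qed
  then show ?thesis
  proof
    assume "\<forall>s. g s > 0"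
    then show ?thesis using reparametrised_periodic_orbit_pos assms by blast
  next
    assume neg: "\<forall>s. g s < 0"
    have "on_periodic_orbit P Q ((\<lambda>s. c (- s)) (- s))"
    proof (rule reparametrised_periodic_orbit_pos[where c = "\<lambda>s. c (- s)" and g = "\<lambda>s. - g (- s)" and S = S])
      fix s
      have "((c \<circ> uminus) has_vector_derivative (- 1) *\<^sub>R g (- s) *\<^sub>R (eval2 P (c (- s)), eval2 Q (c (- s)))) (at s)"
        by (rule vector_diff_chain_at[OF _ c]) (auto intro!: derivative_eq_intros)
      then show "((\<lambda>s. c (- s)) has_vector_derivative - g (- s) *\<^sub>R (eval2 P (c (- s)), eval2 Q (c (- s)))) (at s)"
        by (simp add: o_def)
      show "isCont (\<lambda>s. - g (- s)) s"
        using isCont_o2[of s uminus g] g by (simp add: continuous_minus)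
      show "- g (- (s + S)) = - g (- s)" "c (- (s + S)) = c (- s)"
        using gper[of "- s - S"] cper[of "- s - S"] by simp_all
      show "\<not> (\<lambda>s. c (- s)) constant_on UNIV"
        using nc unfolding constant_on_def by (metis UNIV_I minus_minus)
    qed (use neg \<open>S > 0\<close> in auto)
    then show ?thesis by simp
  qed
qed

section \<open>Quasi-polar coordinates and centers by quadrature\<close>

lemma quasi_polar_coordinates:
  fixes x y :: real
  assumes "(x, y) \<noteq> (0, 0)" and "k > 0"
  obtains r t where "r > 0" "x = r * cos t" "y = r ^ k * sin t"
proof -
  obtain r where r: "r > 0" "(x / r)\<^sup>2 + (y / r ^ k)\<^sup>2 = 1"
  proof (cases "y = 0")
    case True
    then show ?thesis using that[of "\<bar>x\<bar>"] assms by (simp add: power_divide)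
  next
    case False
    \<comment> \<open>The equation for \<open>r\<close>, multiplied by r^(2k), becomes h(r) = 0. In
      this form it can be evaluated at r = 0, where y \<noteq> 0 makes it positive.\<close>
    define h where "h = (\<lambda>r::real. x\<^sup>2 * (r\<^sup>2) ^ (k - 1) + y\<^sup>2 - (r\<^sup>2) ^ k)"
    \<comment> \<open>This choice gives both R \<ge> 1 and R^2 \<ge> x^2 + y^2, which together yield
      h(R) \<le> 0.\<close>
    define R where "R = 1 + \<bar>x\<bar> + \<bar>y\<bar>"
    have "R \<ge> 1" by (simp add: R_def)
    have h0: "h 0 > 0"
      using False \<open>k > 0\<close> by (cases "k - 1") (auto simp: h_def zero_power add_nonneg_pos)
    have "R\<^sup>2 \<ge> x\<^sup>2 + y\<^sup>2"
    proof -
      have "R\<^sup>2 = 1 + x\<^sup>2 + y\<^sup>2 + 2 * \<bar>x\<bar> + 2 * \<bar>y\<bar> + 2 * (\<bar>x\<bar> * \<bar>y\<bar>)"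
        by (simp add: R_def power2_eq_square algebra_simps)
      then show ?thesis using abs_ge_zero[of x] abs_ge_zero[of y] mult_nonneg_nonneg[of "\<bar>x\<bar>" "\<bar>y\<bar>"] by linarith
    qed
    moreover have "(R\<^sup>2) ^ (k - 1) \<ge> 1" using \<open>R \<ge> 1\<close> by (simp add: one_le_power)
    ultimately have "(R\<^sup>2 - x\<^sup>2) * (R\<^sup>2) ^ (k - 1) \<ge> y\<^sup>2 * 1"
      using zero_le_power2[of y] by (intro mult_mono) linarith+
    moreover have "(R\<^sup>2) ^ k = R\<^sup>2 * (R\<^sup>2) ^ (k - 1)" using \<open>k > 0\<close> by (simp add: power_eq_if)
    ultimately have "h R \<le> 0" by (simp add: h_def algebra_simps)
    then obtain r where r: "0 \<le> r" "r \<le> R" "h r = 0"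
      using IVT2[of h R 0 0] h0 \<open>R \<ge> 1\<close> by (auto simp: h_def)
    then have "r > 0" using h0 by (cases "r = 0") auto
    moreover have "(x / r)\<^sup>2 + (y / r ^ k)\<^sup>2 = 1"
    proof -
      have e: "(r ^ k)\<^sup>2 = r\<^sup>2 * (r\<^sup>2) ^ (k - 1)"
        using \<open>k > 0\<close> by (metis power_eq_if power_even_eq power_mult mult.commute gr_implies_not0)
      have "(r\<^sup>2) ^ k = (r ^ k)\<^sup>2" by (metis power_mult mult.commute)
      then have "x\<^sup>2 * (r\<^sup>2) ^ (k - 1) + y\<^sup>2 = (r ^ k)\<^sup>2" using r(3) by (simp add: h_def)
      then show ?thesis using \<open>r > 0\<close> unfolding e power_divide by (simp add: field_simps)
    qed
    ultimately show ?thesis by (rule that)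
  qed
  obtain t where "x / r = cos t" "y / r ^ k = sin t"
    using sincos_total_2pi[OF r(2)] by metis
  then show ?thesis using that[of r t] r(1) by (simp add: field_simps)
qed

text \<open>
  In the coordinates $x = \rho\cos\theta$, $y = \rho^k\sin\theta$ the orbits satisfy
  $d(\ln\rho)/d\theta = (\cos\theta\,P + \sin\theta\,Q) / (\cos\theta\,Q - k\sin\theta\,P)$.
\<close>
lemma qhom_center:
  assumes q: "qhom k m P Q" and "k > 0"
    and V: "\<And>t. cos t * eval2 Q (cos t, sin t) - real k * sin t * eval2 P (cos t, sin t) \<noteq> 0"
    and F: "\<And>t. (F has_real_derivative
      (cos t * eval2 P (cos t, sin t) + sin t * eval2 Q (cos t, sin t)) /
      (cos t * eval2 Q (cos t, sin t) - real k * sin t * eval2 P (cos t, sin t))) (at t)"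
    and Fper: "\<And>t. F (t + 2 * pi) = F t"
  shows "is_center P Q (0, 0)"
proof -
  define p where "p = (\<lambda>t. eval2 P (cos t, sin t))"
  define r where "r = (\<lambda>t. eval2 Q (cos t, sin t))"
  define v where "v = (\<lambda>t. cos t * r t - real k * sin t * p t)"
  have v: "v t \<noteq> 0" for t using V by (simp add: v_def r_def p_def)
  have "on_periodic_orbit P Q (x, y)" if "(x, y) \<noteq> (0, 0)" for x y
  proof -
    obtain \<rho>0 t0 where xy: "\<rho>0 > 0" "x = \<rho>0 * cos t0" "y = \<rho>0 ^ k * sin t0"
      using quasi_polar_coordinates[OF \<open>(x, y) \<noteq> (0, 0)\<close> \<open>k > 0\<close>] by blast
    define \<rho> where "\<rho> = (\<lambda>t. \<rho>0 * exp (F t - F t0))"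
    have pos: "\<rho> t > 0" for t using xy by (simp add: \<rho>_def)
    have d\<rho>: "(\<rho> has_real_derivative \<rho> t * ((cos t * p t + sin t * r t) / v t)) (at t)" for t
      unfolding \<rho>_def by (rule derivative_eq_intros F refl | simp add: v_def r_def p_def)+
    define c where "c = (\<lambda>t. (\<rho> t * cos t, \<rho> t ^ k * sin t))"
    \<comment> \<open>This is time per unit angle, the reciprocal of \<theta>'. The numerator is the
      Jacobian of the quasi-polar coordinates up to a power of \<rho>, and \<rho>^m comes from
      quasi-homogeneity.\<close>
    define g where "g = (\<lambda>t. ((cos t)\<^sup>2 + real k * (sin t)\<^sup>2) / (v t * \<rho> t ^ m))"
    have cP: "eval2 P (c t) = \<rho> t ^ (m + 1) * p t" and cQ: "eval2 Q (c t) = \<rho> t ^ (m + k) * r t" for t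
      using q unfolding qhom_def c_def p_def r_def by blast+
    have "on_periodic_orbit P Q (c t0)"
    proof (rule reparametrised_periodic_orbit[where g = g and S = "2 * pi"])
      fix t
      have dx: "((\<lambda>t. \<rho> t * cos t) has_real_derivative g t * eval2 P (c t)) (at t)"
      proof -
        \<comment> \<open>After clearing \<open>v\<close>, the terms in \<open>r\<close> cancel and
          the Jacobian factor times \<open>p\<close> remains; in the second coordinate it is the
          terms in \<open>p\<close> that cancel.\<close>
        have *: "\<rho> t * ((cos t * p t + sin t * r t) / v t) * cos t + \<rho> t * (- sin t) = g t * eval2 P (c t)"
        proof -
          have "(cos t * p t + sin t * r t) * cos t - sin t * v t = ((cos t)\<^sup>2 + real k * (sin t)\<^sup>2) * p t"
            by (simp add: v_def power2_eq_square algebra_simps)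
          then have "\<rho> t * ((cos t * p t + sin t * r t) * cos t - sin t * v t) / v t = g t * eval2 P (c t)"
            using pos[of t] by (simp add: cP g_def)
          then show ?thesis
            using v[of t] by (simp add: field_simps)
        qed
        show ?thesis
          by (rule derivative_eq_intros d\<rho> refl | simp flip: *)+
      qed
      have dy: "((\<lambda>t. \<rho> t ^ k * sin t) has_real_derivative g t * eval2 Q (c t)) (at t)"
      proof -
        have *: "real k * \<rho> t ^ (k - 1) * (\<rho> t * ((cos t * p t + sin t * r t) / v t)) * sin t + \<rho> t ^ k * cos t
          = g t * eval2 Q (c t)"
        proof -
          have e: "\<rho> t ^ (k - 1) * \<rho> t = \<rho> t ^ k" using \<open>k > 0\<close> by (rule power_minus_mult)
          have "real k * (cos t * p t + sin t * r t) * sin t + cos t * v t = ((cos t)\<^sup>2 + real k * (sin t)\<^sup>2) * r t"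
            by (simp add: v_def power2_eq_square algebra_simps)
          then have "\<rho> t ^ k * (real k * (cos t * p t + sin t * r t) * sin t + cos t * v t) / v t = g t * eval2 Q (c t)"
            using v[of t] pos[of t] by (simp add: cQ g_def power_add field_simps)
          then show ?thesis
            unfolding e[symmetric] using v[of t] by (simp add: field_simps)
        qed
        show ?thesis
          by (rule derivative_eq_intros d\<rho> refl | simp flip: *)+
      qed
      show "(c has_vector_derivative g t *\<^sub>R (eval2 P (c t), eval2 Q (c t))) (at t)"
        using has_vector_derivative_Pair[of "\<lambda>t. \<rho> t * cos t" "g t * eval2 P (c t)" t UNIV
            "\<lambda>t. \<rho> t ^ k * sin t" "g t * eval2 Q (c t)"] dx dy
        unfolding has_real_derivative_iff_has_vector_derivative c_def by simp
      have "isCont \<rho> t" using d\<rho> DERIV_isCont by blast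
      moreover have "isCont v t" unfolding v_def p_def r_def
        by (intro continuous_intros isCont_eval2)
      ultimately show "isCont g t" unfolding g_def
        using v[of t] pos[of t] by (intro continuous_intros) auto
      have "(cos t)\<^sup>2 + real k * (sin t)\<^sup>2 > 0"
      proof -
        have "(cos t)\<^sup>2 + (sin t)\<^sup>2 \<le> (cos t)\<^sup>2 + real k * (sin t)\<^sup>2"
          using \<open>k > 0\<close> mult_right_mono[of 1 "real k" "(sin t)\<^sup>2"] by (simp del: sin_cos_squared_add sin_cos_squared_add2)
        then show ?thesis by simp
      qed
      then show "g t \<noteq> 0" using v[of t] pos[of t] by (simp add: g_def)
      show "g (t + 2 * pi) = g t" "c (t + 2 * pi) = c t"
        by (simp_all add: g_def c_def v_def p_def r_def \<rho>_def Fper)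
    next
      have "fst (c 0) \<noteq> fst (c (pi / 2))" using pos[of 0] by (simp add: c_def)
      then show "\<not> c constant_on UNIV" unfolding constant_on_def by force
    qed simp
    then show ?thesis by (simp add: c_def xy \<rho>_def)
  qed
  moreover have "singular_point P Q (0, 0)"
  proof -
    \<comment> \<open>Scaling the origin by the factor 0 shows that both components vanish
      there.\<close>
    have "eval2 P (0 * 0, 0 ^ k * 0) = 0 ^ (m + 1) * eval2 P (0, 0)"
      "eval2 Q (0 * 0, 0 ^ k * 0) = 0 ^ (m + k) * eval2 Q (0, 0)"
      using q unfolding qhom_def by blast+
    then show ?thesis using \<open>k > 0\<close> by (simp add: singular_point_def zero_power)
  qed
  ultimately show ?thesis
    \<comment> \<open>The neighbourhood is the whole plane: the center is global.\<close>
    unfolding is_center_def by (intro conjI exI[of _ UNIV]) auto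
qed

text \<open>\<open>f\<close> is odd about pi/2 and, by periodicity, about -pi/2, so \<open>F\<close>
  is symmetric about both points. The composition of these two reflections is the translation by 2
  pi.\<close>

lemma reversible_antiderivative_periodic:
  fixes F f :: "real \<Rightarrow> real"
  assumes F: "\<And>t. (F has_real_derivative f t) (at t)"
    and rev: "\<And>t. f (pi - t) = - f t" and per: "\<And>t. f (t + 2 * pi) = f t"
  shows "F (t + 2 * pi) = F t"
proof -
  have refl: "F (a - t) = F t" if a: "\<And>t. f (a - t) = - f t" for a t
  proof -
    have "((\<lambda>t. F (a - t) - F t) has_real_derivative 0) (at t)" for t
      by (rule derivative_eq_intros DERIV_chain2[where f = F, OF F] F refl | simp add: a)+
    then have "F (a - t) - F t = F (a - a / 2) - F (a / 2)"
      using DERIV_isconst_all[of "\<lambda>t. F (a - t) - F t"] by blast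
    then show ?thesis by simp
  qed
  have "f (- pi - t) = - f t" for t
    using rev[of t] per[of "- pi - t"] by (simp add: algebra_simps)
  from refl[of "- pi", OF this] have "F (- pi - t) = F t" .
  moreover have "F (pi - (t + 2 * pi)) = F (t + 2 * pi)" by (rule refl) (rule rev)
  ultimately show ?thesis by (simp add: algebra_simps)
qed

section \<open>The family $\dot x = a x^{j+1} + d y$, $\dot y = b x^{2j+1} + e x^j y$\<close>

text \<open>The systems (A1), (B3), (C2), (D6) are the cases $j = 0, 1, 2, 3$.\<close>
definition famP :: "nat \<Rightarrow> real \<Rightarrow> real \<Rightarrow> real poly poly"
  where "famP j a d = cst a * xvar ^ Suc j + cst d * yvar"

definition famQ :: "nat \<Rightarrow> real \<Rightarrow> real \<Rightarrow> real poly poly"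
  where "famQ j b e = cst b * xvar ^ (2 * j + 1) + cst e * xvar ^ j * yvar"

lemma eval2_fam:
  "eval2 (famP j a d) z = a * fst z ^ Suc j + d * snd z"
  "eval2 (famQ j b e) z = b * fst z * (fst z ^ j)\<^sup>2 + e * fst z ^ j * snd z"
  by (simp_all add: famP_def famQ_def power2_eq_square power_add mult_2)

lemma qhom_fam: "qhom (Suc j) j (famP j a d) (famQ j b e)"
  unfolding qhom_def
  by (auto simp: eval2_fam power_mult_distrib power_add power2_eq_square algebra_simps)

text \<open>The expression equals (n a - e)^2 + 4 n d b, a square once d b = 0.\<close>

lemma fam_disc_imp:
  fixes n a b d e :: real
  assumes "(n * a + e)\<^sup>2 + 4 * n * (b * d - e * a) < 0"
  shows "d * b \<noteq> 0"
proof
  assume "d * b = 0"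
  moreover have "(n * a + e)\<^sup>2 + 4 * n * (b * d - e * a) = (n * a - e)\<^sup>2 + 4 * n * (d * b)"
    by (simp add: power2_eq_square algebra_simps)
  ultimately have "(n * a - e)\<^sup>2 < 0" using assms by (simp only: mult_zero_right add_0_right)
  then show False by simp
qed

text \<open>The hypothesis says that this quadratic form has negative discriminant, and completing
  the square gives definiteness. With x^(j+1) in place of x the form is V = xQ - (j+1)yP.\<close>

lemma fam_form_zero:
  fixes n a b d e x y :: real
  assumes "(n * a + e)\<^sup>2 + 4 * n * (b * d - e * a) < 0"
    and "b * x\<^sup>2 + (e - n * a) * x * y - n * d * y\<^sup>2 = 0"
  shows "x = 0" "y = 0"
proof -
  have D: "(e - n * a)\<^sup>2 + 4 * n * d * b < 0"
    using assms(1) by (simp add: power2_eq_square algebra_simps)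
  have "((e - n * a)\<^sup>2 + 4 * n * d * b) * y\<^sup>2 = (2 * b * x + (e - n * a) * y)\<^sup>2 -
      4 * b * (b * x\<^sup>2 + (e - n * a) * x * y - n * d * y\<^sup>2)"
    by (simp add: power2_eq_square algebra_simps)
  then have "((e - n * a)\<^sup>2 + 4 * n * d * b) * y\<^sup>2 \<ge> 0" using assms(2) by simp
  then show "y = 0" using D by (simp add: zero_le_mult_iff)
  moreover have "b \<noteq> 0" using D by auto
  ultimately show "x = 0" using assms(2) by simp
qed

text \<open>A nonnegative discriminant gives a real root \<open>c\<close> of n d c^2 + (n a - e) c -
  b, hence an invariant curve y = c x^(j+1). Division by \<open>d\<close> is possible because the
  y-axis is not invariant at a center.\<close>

lemma fam_center_imp:
  assumes "is_center (famP j a d) (famQ j b e) (0, 0)"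
  shows "(real (Suc j) * a + e)\<^sup>2 + 4 * real (Suc j) * (b * d - e * a) < 0"
proof (rule ccontr)
  define n where "n = real (Suc j)"
  have "n > 0" by (simp add: n_def)
  assume "\<not> ?thesis"
  then have "(n * a + e)\<^sup>2 + 4 * n * (b * d - e * a) \<ge> 0" unfolding n_def by linarith
  then have D: "(n * a - e)\<^sup>2 + 4 * (n * d) * b \<ge> 0"
    by (simp add: power2_eq_square algebra_simps)
  have P: "famP j a d = xvar * (cst a * xvar ^ j) + cst d * yvar ^ Suc 0"
    by (simp add: famP_def)
  note nec = qhom_center_imp[OF qhom_fam _ P assms]
  have "d \<noteq> 0" using nec(2) by simp
  define s where "s = sqrt ((n * a - e)\<^sup>2 + 4 * (n * d) * b)"
  define c where "c = (s - (n * a - e)) / (2 * (n * d))"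
  have s: "s\<^sup>2 = (n * a - e)\<^sup>2 + 4 * (n * d) * b" using D by (simp add: s_def)
  have c: "2 * (n * d) * c = s - (n * a - e)" using \<open>d \<noteq> 0\<close> \<open>n > 0\<close> by (simp add: c_def)
  have "4 * (n * d) * (n * d * c\<^sup>2 + (n * a - e) * c - b) = (2 * (n * d) * c + (n * a - e))\<^sup>2 - s\<^sup>2"
    unfolding s by (simp add: power2_eq_square algebra_simps)
  also have "\<dots> = 0" by (simp add: c)
  finally have "n * d * c\<^sup>2 + (n * a - e) * c - b = 0" using \<open>d \<noteq> 0\<close> \<open>n > 0\<close> by simp
  then have "eval2 (famQ j b e) (1, c) = n * c * eval2 (famP j a d) (1, c)"
    by (simp add: eval2_fam power2_eq_square algebra_simps)
  then show False using nec(3)[of c] by (simp add: n_def)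
qed

lemma fam_center_even_imp:
  assumes "even j" and ctr: "is_center (famP j a d) (famQ j b e) (0, 0)"
  shows "real (Suc j) * a + e = 0"
proof (rule ccontr)
  define n where "n = real (Suc j)"
  define \<sigma> where "\<sigma> = n * a + e"
  assume "real (Suc j) * a + e \<noteq> 0"
  then have "\<sigma> \<noteq> 0" by (simp add: \<sigma>_def n_def)
  have D: "(n * a + e)\<^sup>2 + 4 * n * (b * d - e * a) < 0"
    using fam_center_imp[OF ctr] by (simp add: n_def)
  then have "d \<noteq> 0" using fam_disc_imp by fastforce
  define V where "V = (\<lambda>x y :: real. b * (x ^ Suc j)\<^sup>2 + (e - n * a) * x ^ Suc j * y - n * d * y\<^sup>2)"
  have V0: "x = 0" if "V x y = 0" for x y
    using fam_form_zero(1)[OF D] that unfolding V_def by (metis power_not_zero)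
  have "\<not> on_periodic_orbit (famP j a d) (famQ j b e) q" for q
  proof (rule not_on_periodic_orbitI, rule allI)
    fix \<gamma> T t0 t
    assume T: "T > 0" "\<And>t. \<gamma> (t + T) = \<gamma> t"
      and dx: "\<And>t. ((\<lambda>t. fst (\<gamma> t)) has_real_derivative eval2 (famP j a d) (\<gamma> t)) (at t)"
      and dy: "\<And>t. ((\<lambda>t. snd (\<gamma> t)) has_real_derivative eval2 (famQ j b e) (\<gamma> t)) (at t)"
    define x y where "x t = fst (\<gamma> t)" and "y t = snd (\<gamma> t)" for t
    note dx' = dx[unfolded eval2_fam, folded x_def y_def]
    note dy' = dy[unfolded eval2_fam, folded x_def y_def]
    \<comment> \<open>The factor \<sigma> x^j is the divergence of the field.\<close>
    have dV: "((\<lambda>t. V (x t) (y t)) has_real_derivative V (x t) (y t) * (\<sigma> * x t ^ j)) (at t)" for t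
      unfolding V_def
      apply (rule derivative_eq_intros dx' dy' refl)+
      apply (simp add: \<sigma>_def n_def power2_eq_square algebra_simps)
      done
    \<comment> \<open>Squaring V and multiplying by \<sigma> removes both unknown signs; for even
      \<open>j\<close> the derivative is nonnegative.\<close>
    have "((\<lambda>t. \<sigma> * (V (x t) (y t))\<^sup>2) has_real_derivative 2 * (\<sigma> * V (x t) (y t))\<^sup>2 * x t ^ j) (at t)" for t
      by (rule derivative_eq_intros dV refl | simp add: power2_eq_square algebra_simps)+
    then have "2 * (\<sigma> * V (x t) (y t))\<^sup>2 * x t ^ j = 0" for t
      by (rule periodic_monotone_deriv_zero[where T = T])
        (use T \<open>even j\<close> in \<open>auto simp: x_def y_def zero_le_even_power\<close>)
    then have x0: "x t = 0" for t
      using \<open>\<sigma> \<noteq> 0\<close> V0 by (metis mult_eq_0_iff power_eq_0_iff zero_neq_numeral)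
    then have "x = (\<lambda>_. 0)" by auto
    then have "(x has_real_derivative 0) (at t)" by simp
    then have "a * x t ^ Suc j + d * y t = 0" using dx' DERIV_unique by blast
    then have "y t = 0" using \<open>d \<noteq> 0\<close> by (simp add: x0)
    then show "eval2 (famP j a d) (\<gamma> t) = 0 \<and> eval2 (famQ j b e) (\<gamma> t) = 0"
      using x0[of t] by (simp add: eval2_fam x_def y_def)
  qed
  then show False
    using no_center_if_no_periodic_orbit ctr unfolding has_center_def by blast
qed

lemma fam_circle:
  fixes j a b d e defines "n \<equiv> real (Suc j)"
  assumes D: "(n * a + e)\<^sup>2 + 4 * n * (b * d - e * a) < 0"
  shows "cos t * eval2 (famQ j b e) (cos t, sin t) - real (Suc j) * sin t * eval2 (famP j a d) (cos t, sin t)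
      = b * (cos t ^ Suc j)\<^sup>2 + (e - n * a) * cos t ^ Suc j * sin t - n * d * (sin t)\<^sup>2" (is "?l = ?r")
    and "cos t * eval2 (famQ j b e) (cos t, sin t) - real (Suc j) * sin t * eval2 (famP j a d) (cos t, sin t) \<noteq> 0"
proof -
  show *: "?l = ?r"
    by (simp add: eval2_fam n_def power2_eq_square algebra_simps)
  show "?l \<noteq> 0"
  proof
    assume "?l = 0"
    then have "cos t ^ Suc j = 0" "sin t = 0" using fam_form_zero[OF D] unfolding * by blast+
    then show False by (metis power_not_zero sin_zero_abs_cos_one abs_zero zero_neq_one)
  qed
qed

text \<open>For odd \<open>j\<close>, P is even and Q is odd in x, so the system is reversible under
  (x, y, t) -> (-x, y, -t). On angles this reflection is t -> pi - t, which changes the sign of the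
  integrand.\<close>

lemma fam_center_odd:
  fixes j a b d e defines "n \<equiv> real (Suc j)"
  assumes D: "(n * a + e)\<^sup>2 + 4 * n * (b * d - e * a) < 0" and "odd j"
  shows "is_center (famP j a d) (famQ j b e) (0, 0)"
proof -
  let ?P = "famP j a d" and ?Q = "famQ j b e"
  define f where "f = (\<lambda>t. (cos t * eval2 ?P (cos t, sin t) + sin t * eval2 ?Q (cos t, sin t)) /
      (cos t * eval2 ?Q (cos t, sin t) - real (Suc j) * sin t * eval2 ?P (cos t, sin t)))"
  note nz = fam_circle(2)[OF D[unfolded n_def]]
  have "isCont f t" for t
    unfolding f_def using nz[of t] by (intro continuous_intros isCont_eval2) auto
  then obtain F where F: "\<And>t. (F has_real_derivative f t) (at t)"
    using ex_antiderivative by blast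
  have "f (pi - t) = - f t" for t
  proof -
    have "cos (pi - t) * eval2 ?P (cos (pi - t), sin (pi - t)) + sin (pi - t) * eval2 ?Q (cos (pi - t), sin (pi - t))
      = - (cos t * eval2 ?P (cos t, sin t) + sin t * eval2 ?Q (cos t, sin t))"
      "cos (pi - t) * eval2 ?Q (cos (pi - t), sin (pi - t)) - real (Suc j) * sin (pi - t) * eval2 ?P (cos (pi - t), sin (pi - t))
      = cos t * eval2 ?Q (cos t, sin t) - real (Suc j) * sin t * eval2 ?P (cos t, sin t)"
      using \<open>odd j\<close> by (simp_all add: eval2_fam power_minus_odd algebra_simps)
    then show ?thesis unfolding f_def by (simp only: minus_divide_left)
  qed
  moreover have "f (t + 2 * pi) = f t" for t by (simp add: f_def)
  ultimately have "F (t + 2 * pi) = F t" for t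
    using reversible_antiderivative_periodic[OF F] by blast
  then show ?thesis
    using qhom_center[OF qhom_fam _ nz, of F] F unfolding f_def by blast
qed

text \<open>V is a first integral with V = \<rho>^(2n) v(\<theta>), so ln \<rho> is, up to a
  constant, -ln(v^2)/(4n). The square takes care of the unknown sign of \<open>v\<close>.\<close>

lemma fam_center_divergence_free:
  fixes j a b d e defines "n \<equiv> real (Suc j)"
  assumes D: "(n * a + e)\<^sup>2 + 4 * n * (b * d - e * a) < 0" and "n * a + e = 0"
  shows "is_center (famP j a d) (famQ j b e) (0, 0)"
proof -
  have e: "e = - (n * a)" and "n > 0" using assms by (simp_all add: n_def)
  define v where "v = (\<lambda>t. b * (cos t ^ Suc j)\<^sup>2 + (e - n * a) * cos t ^ Suc j * sin t - n * d * (sin t)\<^sup>2)"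
  have vV: "cos t * eval2 (famQ j b e) (cos t, sin t) - real (Suc j) * sin t * eval2 (famP j a d) (cos t, sin t) = v t" for t
    using fam_circle(1)[OF D[unfolded n_def], of t] by (simp add: v_def n_def)
  have v0: "v t \<noteq> 0" for t
    using fam_circle(2)[OF D[unfolded n_def], of t] unfolding vV .
  define f where "f = (\<lambda>t. cos t * eval2 (famP j a d) (cos t, sin t) + sin t * eval2 (famQ j b e) (cos t, sin t))"
  have dv: "(v has_real_derivative - (2 * n * f t)) (at t)" for t
    unfolding v_def
    apply (rule derivative_eq_intros refl)+
    apply (simp add: f_def e eval2_fam n_def power2_eq_square algebra_simps)
    done
  have "((\<lambda>t. - ln ((v t)\<^sup>2) / (4 * n)) has_real_derivative f t / v t) (at t)" for t
  proof -
    have d: "((\<lambda>t. (v t)\<^sup>2) has_real_derivative 2 * v t * - (2 * n * f t)) (at t)"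
      by (rule derivative_eq_intros dv refl | simp)+
    have p: "(v t)\<^sup>2 > 0" using v0[of t] by simp
    have "((\<lambda>t. ln ((v t)\<^sup>2)) has_real_derivative 1 / (v t)\<^sup>2 * (2 * v t * - (2 * n * f t))) (at t)"
      by (rule DERIV_chain2[OF DERIV_ln_divide[OF p] d])
    from DERIV_cmult[OF this, of "- 1 / (4 * n)"] show ?thesis
      using v0[of t] \<open>n > 0\<close> by (simp add: power2_eq_square)
  qed
  then show ?thesis
    using qhom_center[OF qhom_fam[of j a d b e], of "\<lambda>t. - ln ((v t)\<^sup>2) / (4 * n)"] v0
    unfolding vV f_def by (simp add: v_def)
qed

lemma fam_center_iff_odd:
  assumes "odd j"
  shows "is_center (famP j a d) (famQ j b e) (0, 0) \<longleftrightarrow> 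
    d * b \<noteq> 0 \<and> (real (Suc j) * a + e)\<^sup>2 + 4 * real (Suc j) * (b * d - e * a) < 0"
  using fam_center_imp fam_center_odd[OF _ assms] fam_disc_imp by blast

lemma fam_center_iff_even:
  assumes "even j"
  shows "is_center (famP j a d) (famQ j b e) (0, 0) \<longleftrightarrow> 
    d * b \<noteq> 0 \<and> (real (Suc j) * a + e)\<^sup>2 + 4 * real (Suc j) * (b * d - e * a) < 0 \<and> real (Suc j) * a + e = 0"
  using fam_center_imp fam_center_divergence_free fam_center_even_imp[OF assms] fam_disc_imp by blast

section \<open>The cubic family with definite quartic form\<close>

text \<open>Clamping the argument to [-1, 1] extends the integrand continuously to the line. This
  provides a two-sided derivative also at the endpoints, which sin 2\<theta> and cos 2\<theta>
  attain.\<close>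

lemma ex_antiderivative_inverse_on_unit_interval:
  fixes q :: "real \<Rightarrow> real"
  assumes q: "continuous_on UNIV q" and pos: "\<And>w. w\<^sup>2 \<le> 1 \<Longrightarrow> q w > 0"
  obtains G where "\<And>w. w\<^sup>2 \<le> 1 \<Longrightarrow> (G has_real_derivative 1 / q w) (at w)"
proof -
  define h :: "real \<Rightarrow> real" where "h w = max (- 1) (min 1 w)" for w
  have h1: "(h w)\<^sup>2 \<le> 1" for w
    by (simp add: abs_square_le_1 h_def abs_le_iff)
  have hw: "h w = w" if "w\<^sup>2 \<le> 1" for w
    using that by (simp add: abs_square_le_1 h_def abs_le_iff)
  have "continuous_on UNIV (\<lambda>w. 1 / q (h w))"
    unfolding h_def
    by (intro continuous_intros continuous_on_compose2[OF q])
      (use pos h1 in \<open>auto simp: h_def less_le\<close>)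
  then obtain G where "\<And>w. (G has_real_derivative 1 / q (h w)) (at w)"
    using ex_antiderivative[of "\<lambda>w. 1 / q (h w)"] by (metis continuous_on_eq_continuous_at open_UNIV UNIV_I)
  then show ?thesis using that[of G] hw by metis
qed

text \<open>Up to the factor \<alpha> this is xQ - yP for (C8) and (C9).\<close>

definition quartic :: "real \<Rightarrow> real \<Rightarrow> real \<Rightarrow> real"
  where "quartic \<mu> x y = x ^ 4 + 6 * \<mu> * x\<^sup>2 * y\<^sup>2 + y ^ 4"

lemma quartic_sin:
  fixes x y \<mu> :: real
  assumes "x\<^sup>2 + y\<^sup>2 \<noteq> 0"
  shows "quartic \<mu> x y = (x\<^sup>2 + y\<^sup>2)\<^sup>2 * (1 + (3 * \<mu> - 1) / 2 * (2 * x * y / (x\<^sup>2 + y\<^sup>2))\<^sup>2)"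
  using assms by (simp add: quartic_def power_divide distrib_left power_mult_distrib) (simp add: power2_eq_square power4_eq_xxxx algebra_simps)

lemma quartic_cos:
  fixes x y \<mu> :: real
  assumes "x\<^sup>2 + y\<^sup>2 \<noteq> 0"
  shows "quartic \<mu> x y = (x\<^sup>2 + y\<^sup>2)\<^sup>2 * (1 + (3 * \<mu> - 1) / 2 * (1 - ((x\<^sup>2 - y\<^sup>2) / (x\<^sup>2 + y\<^sup>2))\<^sup>2))"
proof -
  have "(x\<^sup>2 + y\<^sup>2)\<^sup>2 * (1 + (3 * \<mu> - 1) / 2 * (1 - ((x\<^sup>2 - y\<^sup>2) / (x\<^sup>2 + y\<^sup>2))\<^sup>2)) =
    (x\<^sup>2 + y\<^sup>2)\<^sup>2 + (3 * \<mu> - 1) / 2 * ((x\<^sup>2 + y\<^sup>2)\<^sup>2 - (x\<^sup>2 - y\<^sup>2)\<^sup>2)"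
  proof -
    have "r\<^sup>2 * (1 + k * (1 - (m / r)\<^sup>2)) = r\<^sup>2 + k * (r\<^sup>2 - m\<^sup>2)" if "r \<noteq> 0" for r k m :: real
      using that by (simp add: power_divide field_simps)
    then show ?thesis using assms by blast
  qed
  also have "\<dots> = quartic \<mu> x y"
    by (simp add: quartic_def power2_eq_square power4_eq_xxxx field_simps)
  finally show ?thesis by simp
qed

text \<open>Both expressions are affine in a parameter from [0, 1], with end values 1 and (3\<mu> +
  1)/2; the bound on \<mu> makes the latter positive.\<close>

lemma unit_interval_pos:
  fixes \<mu> w :: real
  assumes "\<mu> > - 1 / 3" "w\<^sup>2 \<le> 1"
  shows "1 + (3 * \<mu> - 1) / 2 * w\<^sup>2 > 0" "1 + (3 * \<mu> - 1) / 2 * (1 - w\<^sup>2) > 0"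
proof -
  have *: "1 + (3 * \<mu> - 1) / 2 * s > 0" if "0 \<le> s" "s \<le> 1" for s
  proof (cases "3 * \<mu> - 1 \<ge> 0")
    case True
    then show ?thesis using that by (simp add: add_pos_nonneg)
  next
    case False
    then have "(3 * \<mu> - 1) / 2 * s \<ge> (3 * \<mu> - 1) / 2 * 1"
      using that by (intro mult_left_mono_neg) auto
    then show ?thesis using assms by simp
  qed
  show "1 + (3 * \<mu> - 1) / 2 * w\<^sup>2 > 0" "1 + (3 * \<mu> - 1) / 2 * (1 - w\<^sup>2) > 0"
    using *[of "w\<^sup>2"] *[of "1 - w\<^sup>2"] assms(2) by simp_all
qed

lemma double_angle_le_1:
  fixes x y :: real
  shows "(2 * x * y / (x\<^sup>2 + y\<^sup>2))\<^sup>2 \<le> 1" "((x\<^sup>2 - y\<^sup>2) / (x\<^sup>2 + y\<^sup>2))\<^sup>2 \<le> 1"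
proof -
  \<comment> \<open>The case b = 0 covers the origin, where the quotients are 0 by the convention
    for division by zero.\<close>
  have *: "(a / b)\<^sup>2 \<le> 1" if "a\<^sup>2 \<le> b\<^sup>2" for a b :: real
    using that by (cases "b = 0") (simp_all add: power_divide)
  have "(x\<^sup>2 + y\<^sup>2)\<^sup>2 - (2 * x * y)\<^sup>2 = (x\<^sup>2 - y\<^sup>2)\<^sup>2" "(x\<^sup>2 + y\<^sup>2)\<^sup>2 - (x\<^sup>2 - y\<^sup>2)\<^sup>2 = (2 * x * y)\<^sup>2"
    by (simp_all add: power2_eq_square algebra_simps)
  then have "(2 * x * y)\<^sup>2 \<le> (x\<^sup>2 + y\<^sup>2)\<^sup>2" "(x\<^sup>2 - y\<^sup>2)\<^sup>2 \<le> (x\<^sup>2 + y\<^sup>2)\<^sup>2"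
    by (smt (verit) zero_le_power2)+
  then show "(2 * x * y / (x\<^sup>2 + y\<^sup>2))\<^sup>2 \<le> 1" "((x\<^sup>2 - y\<^sup>2) / (x\<^sup>2 + y\<^sup>2))\<^sup>2 \<le> 1"
    by (auto intro: *)
qed

lemma quartic_pos:
  assumes "\<mu> > - 1 / 3" "x \<noteq> 0 \<or> y \<noteq> 0"
  shows "quartic \<mu> x y > 0"
proof -
  have "x\<^sup>2 + y\<^sup>2 \<noteq> 0" using assms(2) by (simp add: sum_power2_eq_zero_iff)
  then show ?thesis
    using unit_interval_pos(1)[OF assms(1) double_angle_le_1(1)] quartic_sin[of x y \<mu>] by simp
qed

text \<open>
  With $\theta$ the polar angle, $(x^2 - y^2)\,d\theta / W$ and $xy\,d\theta / W$ are exact on the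
  punctured plane: $W = r^4(1 + \beta\sin^2 2\theta) = r^4(1 + \beta(1 - \cos^2 2\theta))$ with
  $\beta = (3\mu - 1)/2$, so they integrate to functions of $\sin 2\theta$ and $\cos 2\theta$.
\<close>
lemma quartic_exact_forms:
  fixes \<mu> :: real
  assumes \<mu>: "\<mu> > - 1 / 3"
  obtains A B :: "real \<Rightarrow> real \<Rightarrow> real"
  where "\<And>x y x' y' t. \<lbrakk>(x has_real_derivative x') (at t); (y has_real_derivative y') (at t); x t \<noteq> 0 \<or> y t \<noteq> 0\<rbrakk>
      \<Longrightarrow> ((\<lambda>t. A (x t) (y t)) has_real_derivative
        ((x t)\<^sup>2 - (y t)\<^sup>2) * (x t * y' - y t * x') / quartic \<mu> (x t) (y t)) (at t)"
    and "\<And>x y x' y' t. \<lbrakk>(x has_real_derivative x') (at t); (y has_real_derivative y') (at t); x t \<noteq> 0 \<or> y t \<noteq> 0\<rbrakk>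
      \<Longrightarrow> ((\<lambda>t. B (x t) (y t)) has_real_derivative
        x t * y t * (x t * y' - y t * x') / quartic \<mu> (x t) (y t)) (at t)"
proof -
  define \<beta> where "\<beta> = (3 * \<mu> - 1) / 2"
  obtain G where G: "\<And>w. w\<^sup>2 \<le> 1 \<Longrightarrow> (G has_real_derivative 1 / (1 + \<beta> * w\<^sup>2)) (at w)"
  proof (rule ex_antiderivative_inverse_on_unit_interval[of "\<lambda>w. 1 + \<beta> * w\<^sup>2"])
    show "continuous_on UNIV (\<lambda>w. 1 + \<beta> * w\<^sup>2)" by (intro continuous_intros)
  qed (use unit_interval_pos(1)[OF \<mu>] in \<open>auto simp: \<beta>_def\<close>)
  obtain H where H: "\<And>w. w\<^sup>2 \<le> 1 \<Longrightarrow> (H has_real_derivative 1 / (1 + \<beta> * (1 - w\<^sup>2))) (at w)"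
  proof (rule ex_antiderivative_inverse_on_unit_interval[of "\<lambda>w. 1 + \<beta> * (1 - w\<^sup>2)"])
    show "continuous_on UNIV (\<lambda>w. 1 + \<beta> * (1 - w\<^sup>2))" by (intro continuous_intros)
  qed (use unit_interval_pos(2)[OF \<mu>] in \<open>auto simp: \<beta>_def\<close>)
  show ?thesis
  \<comment> \<open>The arguments of \<open>G\<close> and \<open>H\<close> are sin 2\<theta> and cos
    2\<theta>. The factors 1/2 and -1/4 compensate for d(sin 2\<theta>) = 2 cos 2\<theta> d\<theta>
    and d(cos 2\<theta>) = -2 sin 2\<theta> d\<theta>, together with xy = (x^2 + y^2) sin 2\<theta>
    / 2.\<close>
  proof (rule that[of "\<lambda>x y. G (2 * x * y / (x\<^sup>2 + y\<^sup>2)) / 2" "\<lambda>x y. - H ((x\<^sup>2 - y\<^sup>2) / (x\<^sup>2 + y\<^sup>2)) / 4"])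
    fix x y :: "real \<Rightarrow> real" and x' y' t
    assume dx: "(x has_real_derivative x') (at t)" and dy: "(y has_real_derivative y') (at t)"
      and nz: "x t \<noteq> 0 \<or> y t \<noteq> 0"
    define r where "r = (x t)\<^sup>2 + (y t)\<^sup>2"
    \<comment> \<open>\<omega> is \<open>r\<close> times the angular velocity, \<open>r\<close>
      being the squared radius.\<close>
    define \<omega> where "\<omega> = x t * y' - y t * x'"
    have r: "r \<noteq> 0" using nz by (simp add: r_def sum_power2_eq_zero_iff)
    note r' = r[unfolded r_def]
    have dr: "((\<lambda>t. (x t)\<^sup>2 + (y t)\<^sup>2) has_real_derivative 2 * (x t * x' + y t * y')) (at t)"
      by (rule derivative_eq_intros dx dy refl | simp)+
    have dn: "((\<lambda>t. 2 * x t * y t) has_real_derivative 2 * (x' * y t + x t * y')) (at t)"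
      by (rule derivative_eq_intros dx dy refl | simp add: algebra_simps)+
    have dm: "((\<lambda>t. (x t)\<^sup>2 - (y t)\<^sup>2) has_real_derivative 2 * (x t * x' - y t * y')) (at t)"
      by (rule derivative_eq_intros dx dy refl | simp add: algebra_simps)+
    have "2 * (x' * y t + x t * y') * r - 2 * x t * y t * (2 * (x t * x' + y t * y')) = 2 * (((x t)\<^sup>2 - (y t)\<^sup>2) * \<omega>)"
      by (simp add: r_def \<omega>_def power2_eq_square algebra_simps)
    then have d1: "((\<lambda>t. 2 * x t * y t / ((x t)\<^sup>2 + (y t)\<^sup>2)) has_real_derivative
        2 * (((x t)\<^sup>2 - (y t)\<^sup>2) * \<omega>) / r\<^sup>2) (at t)"
      using DERIV_divide[OF dn dr r'] by (simp add: r_def power2_eq_square)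
    have "2 * (x t * x' - y t * y') * r - ((x t)\<^sup>2 - (y t)\<^sup>2) * (2 * (x t * x' + y t * y')) = - 4 * (x t * y t * \<omega>)"
      by (simp add: r_def \<omega>_def power2_eq_square algebra_simps)
    then have d2: "((\<lambda>t. ((x t)\<^sup>2 - (y t)\<^sup>2) / ((x t)\<^sup>2 + (y t)\<^sup>2)) has_real_derivative
        - 4 * (x t * y t * \<omega>) / r\<^sup>2) (at t)"
      using DERIV_divide[OF dm dr r'] by (simp add: r_def power2_eq_square)
    show "((\<lambda>t. G (2 * x t * y t / ((x t)\<^sup>2 + (y t)\<^sup>2)) / 2) has_real_derivative
        ((x t)\<^sup>2 - (y t)\<^sup>2) * (x t * y' - y t * x') / quartic \<mu> (x t) (y t)) (at t)"
      using DERIV_cmult[OF DERIV_chain2[OF G[OF double_angle_le_1(1)] d1], of "1 / 2"]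
      by (simp add: quartic_sin[OF r'] \<omega>_def r_def \<beta>_def mult.commute)
    show "((\<lambda>t. - H (((x t)\<^sup>2 - (y t)\<^sup>2) / ((x t)\<^sup>2 + (y t)\<^sup>2)) / 4) has_real_derivative
        x t * y t * (x t * y' - y t * x') / quartic \<mu> (x t) (y t)) (at t)"
      using DERIV_cmult[OF DERIV_chain2[OF H[OF double_angle_le_1(2)] d2], of "- 1 / 4"]
      by (simp add: quartic_cos[OF r'] \<omega>_def r_def \<beta>_def mult.commute)
  qed
qed

lemma DERIV_quartic:
  assumes dx: "(x has_real_derivative x') (at t)" and dy: "(y has_real_derivative y') (at t)"
  shows "((\<lambda>t. quartic \<mu> (x t) (y t)) has_real_derivative
    (4 * x t ^ 3 + 12 * \<mu> * x t * (y t)\<^sup>2) * x' + (4 * y t ^ 3 + 12 * \<mu> * (x t)\<^sup>2 * y t) * y') (at t)"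
  unfolding quartic_def
  apply (rule derivative_eq_intros dx dy refl)+
  apply (simp add: algebra_simps)
  done

lemma DERIV_ln_quartic:
  assumes "\<mu> > - 1 / 3" and "(x has_real_derivative x') (at t)" and "(y has_real_derivative y') (at t)"
    and "x t \<noteq> 0 \<or> y t \<noteq> 0"
  shows "((\<lambda>t. ln (quartic \<mu> (x t) (y t))) has_real_derivative
    ((4 * x t ^ 3 + 12 * \<mu> * x t * (y t)\<^sup>2) * x' + (4 * y t ^ 3 + 12 * \<mu> * (x t)\<^sup>2 * y t) * y') / quartic \<mu> (x t) (y t)) (at t)"
  using DERIV_chain2[OF DERIV_ln_divide[OF quartic_pos[OF assms(1,4)]] DERIV_quartic[OF assms(2,3)]] by simp

section \<open>The systems (C8), with (C9) as the value \<mu> = 1/3\<close>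

definition cubP :: "real \<Rightarrow> real \<Rightarrow> real \<Rightarrow> real \<Rightarrow> real \<Rightarrow> real poly poly"
  where "cubP p1 p2 p3 \<mu> \<alpha> = cst p1 * xvar^3 + cst (p2 - 3 * \<alpha> * \<mu>) * xvar^2 * yvar + cst p3 * xvar * yvar^2 - cst \<alpha> * yvar^3"

definition cubQ :: "real \<Rightarrow> real \<Rightarrow> real \<Rightarrow> real \<Rightarrow> real \<Rightarrow> real poly poly"
  where "cubQ p1 p2 p3 \<mu> \<alpha> = cst \<alpha> * xvar^3 + cst p1 * xvar^2 * yvar + cst (p2 + 3 * \<alpha> * \<mu>) * xvar * yvar^2 + cst p3 * yvar^3"

lemma cubic_wronskian:
  "fst z * eval2 (cubQ p1 p2 p3 \<mu> \<alpha>) z - snd z * eval2 (cubP p1 p2 p3 \<mu> \<alpha>) z = \<alpha> * quartic \<mu> (fst z) (snd z)"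
  by (simp add: cubP_def cubQ_def quartic_def power2_eq_square power3_eq_cube power4_eq_xxxx algebra_simps)

lemma cubic_quartic_deriv:
  "(4 * fst z ^ 3 + 12 * \<mu> * fst z * (snd z)\<^sup>2) * eval2 (cubP p1 p2 p3 \<mu> \<alpha>) z +
    (4 * snd z ^ 3 + 12 * \<mu> * (fst z)\<^sup>2 * snd z) * eval2 (cubQ p1 p2 p3 \<mu> \<alpha>) z =
    4 * (p1 * (fst z)\<^sup>2 + p2 * fst z * snd z + p3 * (snd z)\<^sup>2) * quartic \<mu> (fst z) (snd z)"
  by (simp add: cubP_def cubQ_def quartic_def power2_eq_square power3_eq_cube power4_eq_xxxx algebra_simps)

lemma cubic_no_periodic_orbit:
  assumes \<mu>: "\<mu> > - 1 / 3" and \<alpha>: "\<alpha> \<in> {1, -1}" and "p1 + p3 \<noteq> 0"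
  shows "\<not> on_periodic_orbit (cubP p1 p2 p3 \<mu> \<alpha>) (cubQ p1 p2 p3 \<mu> \<alpha>) q"
proof (rule not_on_periodic_orbitI)
  let ?P = "cubP p1 p2 p3 \<mu> \<alpha>" and ?Q = "cubQ p1 p2 p3 \<mu> \<alpha>"
  fix \<gamma> T t0
  assume T: "T > 0" "\<And>t. \<gamma> (t + T) = \<gamma> t" and cont: "\<And>t. isCont \<gamma> t"
    and dx: "\<And>t. ((\<lambda>t. fst (\<gamma> t)) has_real_derivative eval2 ?P (\<gamma> t)) (at t)"
    and dy: "\<And>t. ((\<lambda>t. snd (\<gamma> t)) has_real_derivative eval2 ?Q (\<gamma> t)) (at t)"
  define S where "S z = p1 * (fst z)\<^sup>2 + p2 * fst z * snd z + p3 * (snd z)\<^sup>2" for z :: "real \<times> real"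
  define W where "W z = quartic \<mu> (fst z) (snd z)" for z
  have dW: "((\<lambda>t. W (\<gamma> t)) has_real_derivative 4 * S (\<gamma> t) * W (\<gamma> t)) (at t)" for t
    using DERIV_quartic[OF dx dy, of \<mu>] unfolding W_def S_def cubic_quartic_deriv by simp
  have "isCont (\<lambda>t. 4 * S (\<gamma> t)) t" for t
    unfolding S_def by (intro continuous_intros cont)
  then have W0: "W (\<gamma> t) = 0" if "W (\<gamma> s) = 0" for s t
    using zero_of_linear_ode[OF dW _ that] by blast
  \<comment> \<open>W obeys a linear equation along the solution and vanishes only at the origin, so
    a solution through the origin rests there. Any other solution admits ln W and the functions
    \<open>A\<close> and \<open>B\<close> at all times.\<close>
  show "\<forall>t. eval2 ?P (\<gamma> t) = 0 \<and> eval2 ?Q (\<gamma> t) = 0"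
  proof (cases "\<exists>s. \<gamma> s = (0, 0)")
    case True
    then obtain s where "\<gamma> s = (0, 0)" ..
    then have "W (\<gamma> s) = 0" by (simp add: W_def quartic_def)
    then have "W (\<gamma> t) = 0" for t by (rule W0)
    then have "fst (\<gamma> t) = 0 \<and> snd (\<gamma> t) = 0" for t
      using quartic_pos[OF \<mu>, of "fst (\<gamma> t)" "snd (\<gamma> t)"] by (auto simp: W_def)
    then show ?thesis by (simp add: cubP_def cubQ_def)
  next
    case False
    then have nz: "fst (\<gamma> t) \<noteq> 0 \<or> snd (\<gamma> t) \<noteq> 0" for t by (metis prod.collapse)
    have Wnz: "quartic \<mu> (fst (\<gamma> t)) (snd (\<gamma> t)) \<noteq> 0" for t using quartic_pos[OF \<mu> nz] by (metis less_irrefl)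
    obtain A B where AB:
      "\<And>x y x' y' t. \<lbrakk>(x has_real_derivative x') (at t); (y has_real_derivative y') (at t); x t \<noteq> 0 \<or> y t \<noteq> 0\<rbrakk>
      \<Longrightarrow> ((\<lambda>t. A (x t) (y t)) has_real_derivative
        ((x t)\<^sup>2 - (y t)\<^sup>2) * (x t * y' - y t * x') / quartic \<mu> (x t) (y t)) (at t)"
      "\<And>x y x' y' t. \<lbrakk>(x has_real_derivative x') (at t); (y has_real_derivative y') (at t); x t \<noteq> 0 \<or> y t \<noteq> 0\<rbrakk>
      \<Longrightarrow> ((\<lambda>t. B (x t) (y t)) has_real_derivative
        x t * y t * (x t * y' - y t * x') / quartic \<mu> (x t) (y t)) (at t)"
      using quartic_exact_forms[OF \<mu>] by blast
    have dA: "((\<lambda>t. A (fst (\<gamma> t)) (snd (\<gamma> t))) has_real_derivative ((fst (\<gamma> t))\<^sup>2 - (snd (\<gamma> t))\<^sup>2) * \<alpha>) (at t)" for t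
      using AB(1)[OF dx[of t] dy[of t] nz[of t]] Wnz[of t] by (simp add: cubic_wronskian)
    have dB: "((\<lambda>t. B (fst (\<gamma> t)) (snd (\<gamma> t))) has_real_derivative fst (\<gamma> t) * snd (\<gamma> t) * \<alpha>) (at t)" for t
      using AB(2)[OF dx[of t] dy[of t] nz[of t]] Wnz[of t] by (simp add: cubic_wronskian mult.assoc)
    have dL: "((\<lambda>t. ln (quartic \<mu> (fst (\<gamma> t)) (snd (\<gamma> t)))) has_real_derivative 4 * S (\<gamma> t)) (at t)" for t
      using DERIV_ln_quartic[OF \<mu> dx[of t] dy[of t] nz[of t]] Wnz[of t] by (simp add: cubic_quartic_deriv S_def)
    \<comment> \<open>S splits as (p1 + p3)/2 (x^2 + y^2) + (p1 - p3)/2 (x^2 - y^2) + p2 x y. The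
      terms in \<open>A\<close> and \<open>B\<close> cancel the last two summands, and the outer
      factor p1 + p3 makes the derivative nonnegative for either sign of that sum.\<close>
    define L where "L z = (p1 + p3) * (ln (quartic \<mu> (fst z) (snd z)) / 4 -
      \<alpha> * (p1 - p3) / 2 * A (fst z) (snd z) - \<alpha> * p2 * B (fst z) (snd z))" for z
    have "((\<lambda>t. L (\<gamma> t)) has_real_derivative (p1 + p3) * (4 * S (\<gamma> t) / 4 -
      \<alpha> * (p1 - p3) / 2 * (((fst (\<gamma> t))\<^sup>2 - (snd (\<gamma> t))\<^sup>2) * \<alpha>) - \<alpha> * p2 * (fst (\<gamma> t) * snd (\<gamma> t) * \<alpha>))) (at t)" for t
      unfolding L_def by (intro DERIV_cmult DERIV_diff DERIV_cdivide dA dB dL)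
    moreover have "(p1 + p3) * (4 * S z / 4 -
      \<alpha> * (p1 - p3) / 2 * (((fst z)\<^sup>2 - (snd z)\<^sup>2) * \<alpha>) - \<alpha> * p2 * (fst z * snd z * \<alpha>)) =
      (p1 + p3)\<^sup>2 / 2 * ((fst z)\<^sup>2 + (snd z)\<^sup>2)" for z
      using \<alpha> by (auto simp: S_def power2_eq_square field_simps)
    ultimately have dLL: "((\<lambda>t. L (\<gamma> t)) has_real_derivative (p1 + p3)\<^sup>2 / 2 * ((fst (\<gamma> t))\<^sup>2 + (snd (\<gamma> t))\<^sup>2)) (at t)" for t
      by (simp only:)
    have "(p1 + p3)\<^sup>2 / 2 * ((fst (\<gamma> 0))\<^sup>2 + (snd (\<gamma> 0))\<^sup>2) = 0"
      by (rule periodic_monotone_deriv_zero[OF dLL _ T(1)]) (simp_all add: T(2))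
    then show ?thesis using \<open>p1 + p3 \<noteq> 0\<close> nz[of 0] by (simp add: sum_power2_eq_zero_iff)
  qed
qed

lemma qhom_cubic: "qhom 1 2 (cubP p1 p2 p3 \<mu> \<alpha>) (cubQ p1 p2 p3 \<mu> \<alpha>)"
  unfolding qhom_def
  by (simp add: cubP_def cubQ_def power2_eq_square power3_eq_cube algebra_simps)

lemma cubic_center:
  assumes \<mu>: "\<mu> > - 1 / 3" and \<alpha>: "\<alpha> \<in> {1, -1}" and p3: "p3 = - p1"
  shows "is_center (cubP p1 p2 p3 \<mu> \<alpha>) (cubQ p1 p2 p3 \<mu> \<alpha>) (0, 0)"
proof -
  let ?P = "cubP p1 p2 p3 \<mu> \<alpha>" and ?Q = "cubQ p1 p2 p3 \<mu> \<alpha>"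
  have nz: "cos t \<noteq> 0 \<or> sin t \<noteq> 0" for t :: real
    by (metis sin_zero_abs_cos_one abs_zero zero_neq_one)
  have Wnz: "quartic \<mu> (cos t) (sin t) \<noteq> 0" for t using quartic_pos[OF \<mu> nz] by (metis less_irrefl)
  obtain A B where AB:
    "\<And>x y x' y' t. \<lbrakk>(x has_real_derivative x') (at t); (y has_real_derivative y') (at t); x t \<noteq> 0 \<or> y t \<noteq> 0\<rbrakk>
    \<Longrightarrow> ((\<lambda>t. A (x t) (y t)) has_real_derivative
      ((x t)\<^sup>2 - (y t)\<^sup>2) * (x t * y' - y t * x') / quartic \<mu> (x t) (y t)) (at t)"
    "\<And>x y x' y' t. \<lbrakk>(x has_real_derivative x') (at t); (y has_real_derivative y') (at t); x t \<noteq> 0 \<or> y t \<noteq> 0\<rbrakk>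
    \<Longrightarrow> ((\<lambda>t. B (x t) (y t)) has_real_derivative
      x t * y t * (x t * y' - y t * x') / quartic \<mu> (x t) (y t)) (at t)"
    using quartic_exact_forms[OF \<mu>] by blast
  have sq: "cos t * cos t - sin t * - sin t = 1" for t :: real
    using sin_cos_squared_add[of t] by (simp add: power2_eq_square)
  have dA: "((\<lambda>t. A (cos t) (sin t)) has_real_derivative ((cos t)\<^sup>2 - (sin t)\<^sup>2) / quartic \<mu> (cos t) (sin t)) (at t)" for t
    using AB(1)[OF DERIV_cos DERIV_sin nz[of t]] unfolding sq by simp
  have dB: "((\<lambda>t. B (cos t) (sin t)) has_real_derivative cos t * sin t / quartic \<mu> (cos t) (sin t)) (at t)" for t
    using AB(2)[OF DERIV_cos DERIV_sin nz[of t]] unfolding sq by simp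
  \<comment> \<open>For p3 = -p1, the relation d(ln W)/4 = \<alpha> (p1 dA + p2 dB) holds along
    orbits. Since W = \<rho>^4 w(\<theta>), solving for ln \<rho> gives \<open>F\<close>, which is
    periodic because it depends on cos and sin only.\<close>
  define F where "F t = \<alpha> * p1 * A (cos t) (sin t) + \<alpha> * p2 * B (cos t) (sin t) -
    ln (quartic \<mu> (cos t) (sin t)) / 4" for t
  have F: "(F has_real_derivative \<alpha> * p1 * (((cos t)\<^sup>2 - (sin t)\<^sup>2) / quartic \<mu> (cos t) (sin t)) +
    \<alpha> * p2 * (cos t * sin t / quartic \<mu> (cos t) (sin t)) -
    ((4 * cos t ^ 3 + 12 * \<mu> * cos t * (sin t)\<^sup>2) * - sin t +
     (4 * sin t ^ 3 + 12 * \<mu> * (cos t)\<^sup>2 * sin t) * cos t) / quartic \<mu> (cos t) (sin t) / 4) (at t)" for t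
    unfolding F_def by (intro DERIV_add DERIV_diff DERIV_cmult DERIV_cdivide dA dB DERIV_ln_quartic \<mu> nz DERIV_cos DERIV_sin)
  \<comment> \<open>Since \<alpha>^2 = 1, dividing by \<alpha> W amounts to multiplying by \<alpha>
    and dividing by W.\<close>
  have num: "\<alpha> * (cos t * eval2 ?P (cos t, sin t) + sin t * eval2 ?Q (cos t, sin t)) =
    \<alpha> * p1 * ((cos t)\<^sup>2 - (sin t)\<^sup>2) + \<alpha> * p2 * (cos t * sin t) -
    ((4 * cos t ^ 3 + 12 * \<mu> * cos t * (sin t)\<^sup>2) * - sin t +
     (4 * sin t ^ 3 + 12 * \<mu> * (cos t)\<^sup>2 * sin t) * cos t) / 4" for t
  proof -
    have "cos t * eval2 ?P (cos t, sin t) + sin t * eval2 ?Q (cos t, sin t) =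
      ((cos t)\<^sup>2 + (sin t)\<^sup>2) * (p1 * ((cos t)\<^sup>2 - (sin t)\<^sup>2) + p2 * (cos t * sin t)) +
      \<alpha> * (1 - 3 * \<mu>) * cos t * sin t * ((cos t)\<^sup>2 - (sin t)\<^sup>2)"
      unfolding p3 by (simp add: cubP_def cubQ_def power2_eq_square power3_eq_cube algebra_simps del: sin_cos_squared_add sin_cos_squared_add2 sin_cos_squared_add3)
    then show ?thesis
      using \<alpha> by (auto simp: power2_eq_square power3_eq_cube field_simps sin_cos_squared_add2[unfolded power2_eq_square])
  qed
  have V: "cos t * eval2 ?Q (cos t, sin t) - real 1 * sin t * eval2 ?P (cos t, sin t) = \<alpha> * quartic \<mu> (cos t) (sin t)" for t
    using cubic_wronskian[of "(cos t, sin t)"] by simp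
  have \<alpha>2: "u / (\<alpha> * w) = \<alpha> * u / w" for u w :: real using \<alpha> by auto
  have e: "(k * u + l * v - z / 4) / w = k * (u / w) + l * (v / w) - z / w / 4" for k l u v w z :: real
    by (simp add: add_divide_distrib diff_divide_distrib)
  show ?thesis
  proof (rule qhom_center[OF qhom_cubic, where F = F], unfold V)
    show "\<alpha> * quartic \<mu> (cos t) (sin t) \<noteq> 0" for t using Wnz \<alpha> by auto
    show "(F has_real_derivative (cos t * eval2 ?P (cos t, sin t) + sin t * eval2 ?Q (cos t, sin t)) /
      (\<alpha> * quartic \<mu> (cos t) (sin t))) (at t)" for t
      by (simp only: \<alpha>2 num e F)
    show "F (t + 2 * pi) = F t" for t by (simp add: F_def)
  qed simp
qed

lemma cubic_has_center_iff:
  assumes "\<mu> > - 1 / 3" "\<alpha> \<in> {1, -1}"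
  shows "has_center (cubP p1 p2 p3 \<mu> \<alpha>) (cubQ p1 p2 p3 \<mu> \<alpha>) \<longleftrightarrow> p3 = - p1"
proof
  assume c: "has_center (cubP p1 p2 p3 \<mu> \<alpha>) (cubQ p1 p2 p3 \<mu> \<alpha>)"
  have "p1 + p3 = 0"
    using no_center_if_no_periodic_orbit cubic_no_periodic_orbit[OF assms] c by blast
  then show "p3 = - p1" by simp
next
  assume "p3 = - p1"
  then show "has_center (cubP p1 p2 p3 \<mu> \<alpha>) (cubQ p1 p2 p3 \<mu> \<alpha>)"
    unfolding has_center_def using cubic_center[OF assms] by blast
qed

section \<open>The remaining systems\<close>

text \<open>For a = 0 the y-axis is invariant, so a root \<open>c\<close> has to be found only for
  nonzero \<open>a\<close>.\<close>

lemma qhom_no_center: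
  assumes "qhom k m P Q" "k > 0" "P = xvar * P1 + cst a * yvar ^ Suc i"
    and "a \<noteq> 0 \<Longrightarrow> \<exists>c. eval2 Q (1, c) = real k * c * eval2 P (1, c)"
  shows "\<not> has_center P Q"
  using qhom_center_imp[OF assms(1-3)] assms(4) unfolding has_center_def by blast

text \<open>The system is triangular: a periodic first coordinate is constant, and then the second
  one obeys a scalar autonomous equation.\<close>

lemma no_center_A2:
  "\<not> has_center (cst a * xvar) (cst b * xvar ^ p + cst d * yvar)" (is "\<not> has_center ?P ?Q")
proof (rule no_center_if_no_periodic_orbit, rule not_on_periodic_orbitI, rule allI)
  fix \<gamma> T t0 t
  assume T: "T > 0" "\<And>t. \<gamma> (t + T) = \<gamma> t"
    and dx: "\<And>t. ((\<lambda>t. fst (\<gamma> t)) has_real_derivative eval2 ?P (\<gamma> t)) (at t)"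
    and dy: "\<And>t. ((\<lambda>t. snd (\<gamma> t)) has_real_derivative eval2 ?Q (\<gamma> t)) (at t)"
  have ax: "a * fst (\<gamma> t) = 0" for t
    by (rule scalar_periodic_stationary[where x = "\<lambda>t. fst (\<gamma> t)" and g = "\<lambda>x. a * x" and T = T])
      (use dx T in auto)
  define c where "c = fst (\<gamma> 0)"
  have x: "fst (\<gamma> t) = c" for t
    unfolding c_def by (rule deriv_zero_imp_constant[OF dx]) (use ax in simp)
  have "b * c ^ p + d * snd (\<gamma> t) = 0"
    by (rule scalar_periodic_stationary[where x = "\<lambda>t. snd (\<gamma> t)" and g = "\<lambda>y. b * c ^ p + d * y" and T = T])
      (use dy T in \<open>auto simp: x\<close>)
  then show "eval2 ?P (\<gamma> t) = 0 \<and> eval2 ?Q (\<gamma> t) = 0"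
    using ax[of t] x[of t] by simp
qed

text \<open>Here b y' = b^2 x^k is nonnegative, so b y is monotone; periodicity makes y constant and
  leaves a scalar equation for x.\<close>

lemma no_center_even_force:
  "\<not> has_center (cst a * yvar) (cst b * xvar ^ k)" (is "\<not> has_center ?P ?Q") if "even k"
proof (rule no_center_if_no_periodic_orbit, rule not_on_periodic_orbitI, rule allI)
  fix \<gamma> T t0 t
  assume T: "T > 0" "\<And>t. \<gamma> (t + T) = \<gamma> t"
    and dx: "\<And>t. ((\<lambda>t. fst (\<gamma> t)) has_real_derivative eval2 ?P (\<gamma> t)) (at t)"
    and dy: "\<And>t. ((\<lambda>t. snd (\<gamma> t)) has_real_derivative eval2 ?Q (\<gamma> t)) (at t)"
  have "((\<lambda>t. b * snd (\<gamma> t)) has_real_derivative b\<^sup>2 * fst (\<gamma> t) ^ k) (at t)" for t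
    using DERIV_cmult[OF dy, of b] by (simp add: power2_eq_square mult.assoc)
  then have "b\<^sup>2 * fst (\<gamma> t) ^ k = 0" for t
    by (rule periodic_monotone_deriv_zero[where T = T]) (use T \<open>even k\<close> in \<open>auto simp: zero_le_even_power\<close>)
  then have Q: "b * fst (\<gamma> t) ^ k = 0" for t by simp
  define c where "c = snd (\<gamma> 0)"
  have y: "snd (\<gamma> t) = c" for t
    unfolding c_def by (rule deriv_zero_imp_constant[OF dy]) (use Q in simp)
  have "a * c = 0"
    by (rule scalar_periodic_stationary[where x = "\<lambda>t. fst (\<gamma> t)" and g = "\<lambda>_. a * c" and T = T])
      (use dx T in \<open>auto simp: y\<close>)
  then show "eval2 ?P (\<gamma> t) = 0 \<and> eval2 ?Q (\<gamma> t) = 0"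
    using Q y[of t] by simp
qed

text \<open>The weights are $(2,3)$ here, so the results for weights $(1,k)$ do not apply.\<close>
lemma no_center_D4:
  "\<not> has_center (cst a * xvar * yvar) (cst b * xvar ^ 3 + cst d * yvar ^ 2)" (is "\<not> has_center ?P ?Q")
proof
  assume "has_center ?P ?Q"
  then obtain x0 y0 where ctr: "is_center ?P ?Q (x0, y0)" unfolding has_center_def by auto
  have "xvar dvd ?P" by (simp add: mult.assoc)
  note ax = y_axis_not_periodic[OF this]
  have "\<not> is_center ?P ?Q (0, y0)"
    by (rule not_center_curve[where c = "\<lambda>r. (0, r)" and s = y0]) (auto simp: ax intro!: continuous_intros)
  then have "x0 \<noteq> 0" using ctr by auto
  have sing: "a * x0 * y0 = 0" "b * x0 ^ 3 + d * y0\<^sup>2 = 0"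
    using ctr by (simp_all add: is_center_def singular_point_def)
  have "\<not> on_periodic_orbit ?P ?Q q" for q
  proof (rule not_on_periodic_orbitI)
    fix \<gamma> T t0
    assume T: "T > 0" "\<And>t. \<gamma> (t + T) = \<gamma> t"
      and dx: "\<And>t. ((\<lambda>t. fst (\<gamma> t)) has_real_derivative eval2 ?P (\<gamma> t)) (at t)"
      and dy: "\<And>t. ((\<lambda>t. snd (\<gamma> t)) has_real_derivative eval2 ?Q (\<gamma> t)) (at t)"
    show "\<forall>t. eval2 ?P (\<gamma> t) = 0 \<and> eval2 ?Q (\<gamma> t) = 0"
    proof (cases "a = 0")
      case True
      define c where "c = fst (\<gamma> 0)"
      have x: "fst (\<gamma> t) = c" for t
        unfolding c_def by (rule deriv_zero_imp_constant[OF dx]) (simp add: True)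
      have "b * c ^ 3 + d * (snd (\<gamma> t))\<^sup>2 = 0" for t
        by (rule scalar_periodic_stationary[where x = "\<lambda>t. snd (\<gamma> t)" and g = "\<lambda>y. b * c ^ 3 + d * y\<^sup>2" and T = T])
          (use dy T in \<open>auto simp: x\<close>)
      then show ?thesis using x True by simp
    next
      case False
      \<comment> \<open>The center lies off the invariant y-axis, so a \<noteq> 0 forces y0 = 0 and
        then b x0^3 = 0. With b = 0 the equation for y decouples.\<close>
      then have "b = 0" using sing \<open>x0 \<noteq> 0\<close> by auto
      have Q: "d * (snd (\<gamma> t))\<^sup>2 = 0" for t
        by (rule scalar_periodic_stationary[where x = "\<lambda>t. snd (\<gamma> t)" and g = "\<lambda>y. d * y\<^sup>2" and T = T])
          (use dy T \<open>b = 0\<close> in auto)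
      define c where "c = snd (\<gamma> 0)"
      have y: "snd (\<gamma> t) = c" for t
        unfolding c_def by (rule deriv_zero_imp_constant[OF dy]) (use Q \<open>b = 0\<close> in simp)
      have "a * fst (\<gamma> t) * c = 0" for t
        by (rule scalar_periodic_stationary[where x = "\<lambda>t. fst (\<gamma> t)" and g = "\<lambda>x. a * x * c" and T = T])
          (use dx T in \<open>auto simp: y\<close>)
      then show ?thesis using Q y \<open>b = 0\<close> by simp
    qed
  qed
  then show False
    using no_center_if_no_periodic_orbit ctr unfolding has_center_def by blast
qed

section \<open>Invariant curves from roots of odd-degree equations or by inspection\<close>

lemma cubic_root:
  fixes c0 c1 c2 c3 :: real
  assumes "c3 \<noteq> 0"
  shows "\<exists>c. c0 + c1 * c + c2 * c ^ 2 + c3 * c ^ 3 = 0"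
  using odd_degree_imp_root[of "[:c0, c1, c2, c3:]"] assms
  by (auto simp: power2_eq_square power3_eq_cube algebra_simps)

lemma quintic_root:
  fixes c0 c1 c2 c3 c4 c5 :: real
  assumes "c5 \<noteq> 0"
  shows "\<exists>c. c0 + c1 * c + c2 * c ^ 2 + c3 * c ^ 3 + c4 * c ^ 4 + c5 * c ^ 5 = 0"
proof -
  have "degree [:c0, c1, c2, c3, c4, c5:] = 5" using assms by simp
  then obtain c where "poly [:c0, c1, c2, c3, c4, c5:] c = 0"
    using odd_degree_imp_root[of "[:c0, c1, c2, c3, c4, c5:]"] by fastforce
  then show ?thesis by (intro exI[of _ c]) (simp add: eval_nat_numeral algebra_simps)
qed

text \<open>Q(1, c) - c P(1, c) is a cubic in c with leading coefficient -a02. (D1) gives a quintic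
  in the same way, and (D2), with k = 2, a cubic.\<close>

lemma no_center_B1:
  "\<not> has_center (cst a20 * xvar^2 + cst a11 * xvar * yvar + cst a02 * yvar^2)
    (cst b20 * xvar^2 + cst b11 * xvar * yvar + cst b02 * yvar^2)" (is "\<not> has_center ?P ?Q")
proof (rule qhom_no_center[where k = 1 and m = 1 and i = 1 and a = a02 and ?P1.0 = "cst a20 * xvar + cst a11 * yvar"])
  assume "a02 \<noteq> 0"
  then obtain c where "b20 + (b11 - a20) * c + (b02 - a11) * c ^ 2 + (- a02) * c ^ 3 = 0"
    using cubic_root[of "- a02"] by fastforce
  then show "\<exists>c. eval2 ?Q (1, c) = real 1 * c * eval2 ?P (1, c)"
    by (intro exI[of _ c]) (simp add: power2_eq_square power3_eq_cube algebra_simps)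
qed (simp_all add: qhom_def power2_eq_square algebra_simps)

lemma no_center_D1:
  "\<not> has_center (cst a40 * xvar^4 + cst a31 * xvar^3 * yvar + cst a22 * xvar^2 * yvar^2 + cst a13 * xvar * yvar^3 + cst a04 * yvar^4)
    (cst b40 * xvar^4 + cst b31 * xvar^3 * yvar + cst b22 * xvar^2 * yvar^2 + cst b13 * xvar * yvar^3 + cst b04 * yvar^4)"
  (is "\<not> has_center ?P ?Q")
proof (rule qhom_no_center[where k = 1 and m = 3 and i = 3 and a = a04
      and ?P1.0 = "cst a40 * xvar^3 + cst a31 * xvar^2 * yvar + cst a22 * xvar * yvar^2 + cst a13 * yvar^3"])
  assume "a04 \<noteq> 0"
  then obtain c where "b40 + (b31 - a40) * c + (b22 - a31) * c ^ 2 + (b13 - a22) * c ^ 3 + (b04 - a13) * c ^ 4 + (- a04) * c ^ 5 = 0"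
    using quintic_root[of "- a04"] by fastforce
  then show "\<exists>c. eval2 ?Q (1, c) = real 1 * c * eval2 ?P (1, c)"
    by (intro exI[of _ c]) (simp add: eval_nat_numeral algebra_simps)
qed (simp_all add: qhom_def eval_nat_numeral algebra_simps)

lemma no_center_D2:
  "\<not> has_center (cst a40 * xvar^4 + cst a21 * xvar^2 * yvar + cst a02 * yvar^2)
    (cst b50 * xvar^5 + cst b31 * xvar^3 * yvar + cst b12 * xvar * yvar^2)" (is "\<not> has_center ?P ?Q")
proof (rule qhom_no_center[where k = 2 and m = 3 and i = 1 and a = a02
      and ?P1.0 = "cst a40 * xvar^3 + cst a21 * xvar * yvar"])
  assume "a02 \<noteq> 0"
  then obtain c where "b50 + (b31 - 2 * a40) * c + (b12 - 2 * a21) * c ^ 2 + (- 2 * a02) * c ^ 3 = 0"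
    using cubic_root[of "- 2 * a02"] by fastforce
  then show "\<exists>c. eval2 ?Q (1, c) = real 2 * c * eval2 ?P (1, c)"
    by (intro exI[of _ c]) (simp add: power2_eq_square power3_eq_cube algebra_simps)
qed (simp_all add: qhom_def eval_nat_numeral algebra_simps)

text \<open>P is divisible by x, so the y-axis is invariant; this is the case a = 0, and the same
  holds for (D3).\<close>

lemma no_center_C1:
  "\<not> has_center (cst a30 * xvar^3 + cst a11 * xvar * yvar)
    (cst b40 * xvar^4 + cst b21 * xvar^2 * yvar + cst b02 * yvar^2)"
  by (rule qhom_no_center[where k = 2 and m = 2 and i = 0 and a = 0 and ?P1.0 = "cst a30 * xvar^2 + cst a11 * yvar"])
    (simp_all add: qhom_def cst_def[of 0] eval_nat_numeral algebra_simps)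

lemma no_center_D3:
  "\<not> has_center (cst a40 * xvar^4 + cst a11 * xvar * yvar)
    (cst b60 * xvar^6 + cst b31 * xvar^3 * yvar + cst b02 * yvar^2)"
  by (rule qhom_no_center[where k = 3 and m = 3 and i = 0 and a = 0 and ?P1.0 = "cst a40 * xvar^3 + cst a11 * yvar"])
    (simp_all add: qhom_def cst_def[of 0] eval_nat_numeral algebra_simps)

lemma no_center_cubic_invariant_line:
  assumes P: "P = cst a30 * xvar^3 + cst a21 * xvar^2 * yvar + cst a12 * xvar * yvar^2 + cst a03 * yvar^3"
    and Q: "Q = cst b30 * xvar^3 + cst b21 * xvar^2 * yvar + cst b12 * xvar * yvar^2 + cst b03 * yvar^3"
    and c: "eval2 Q (1, c) = c * eval2 P (1, c)"
  shows "\<not> has_center P Q"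
proof (rule qhom_no_center[where k = 1 and m = 2 and i = 2 and a = a03
      and ?P1.0 = "cst a30 * xvar^2 + cst a21 * xvar * yvar + cst a12 * yvar^2"])
  show "\<exists>c. eval2 Q (1, c) = real 1 * c * eval2 P (1, c)" using c by auto
qed (simp_all add: qhom_def P Q eval_nat_numeral algebra_simps)

lemma cst_arith: "cst (- a) = - cst a" "cst 0 = 0"
  by (simp_all add: cst_def)

text \<open>The line y = x is invariant for (C3), where P(1, 1) = Q(1, 1). In the second pattern,
  which covers (C4) to (C7), and in (C10), Q is divisible by y, so y = 0 is invariant.\<close>

lemma no_center_C3_to_C7_C10:
  fixes p1 p2 p3 \<mu> \<alpha> :: real
  shows "\<not> has_center (cst p1 * xvar^3 + cst p2 * xvar^2 * yvar + cst p3 * xvar * yvar^2 + cst \<mu> * yvar^3)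
      (cst \<mu> * xvar^3 + cst p1 * xvar^2 * yvar + cst p2 * xvar * yvar^2 + cst p3 * yvar^3)"
    and "\<not> has_center (cst a30 * xvar^3 + cst a21 * xvar^2 * yvar + cst a12 * xvar * yvar^2 - cst a03 * yvar^3)
      (cst b21 * xvar^2 * yvar + cst b12 * xvar * yvar^2 + cst b03 * yvar^3)"
    and "\<not> has_center (xvar * (cst p1 * xvar^2 + cst p2 * xvar * yvar + cst p3 * yvar^2))
      (yvar * (cst p1 * xvar^2 + cst p2 * xvar * yvar + cst p3 * yvar^2))"
proof -
  show "\<not> has_center (cst p1 * xvar^3 + cst p2 * xvar^2 * yvar + cst p3 * xvar * yvar^2 + cst \<mu> * yvar^3)
      (cst \<mu> * xvar^3 + cst p1 * xvar^2 * yvar + cst p2 * xvar * yvar^2 + cst p3 * yvar^3)"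
    by (rule no_center_cubic_invariant_line[OF refl refl, where c = 1]) simp
  show "\<not> has_center (cst a30 * xvar^3 + cst a21 * xvar^2 * yvar + cst a12 * xvar * yvar^2 - cst a03 * yvar^3)
      (cst b21 * xvar^2 * yvar + cst b12 * xvar * yvar^2 + cst b03 * yvar^3)"
    by (rule no_center_cubic_invariant_line[of _ a30 a21 a12 "- a03" _ 0 b21 b12 b03 0])
      (simp_all add: cst_arith)
  show "\<not> has_center (xvar * (cst p1 * xvar^2 + cst p2 * xvar * yvar + cst p3 * yvar^2))
      (yvar * (cst p1 * xvar^2 + cst p2 * xvar * yvar + cst p3 * yvar^2))"
    by (rule no_center_cubic_invariant_line[of _ p1 p2 p3 0 _ 0 p1 p2 p3 0])
      (simp_all add: cst_arith eval_nat_numeral algebra_simps)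
qed

section \<open>Specialisation to the individual center criteria\<close>

lemma center_A1:
  "is_center (cst a10 * xvar + cst a01 * yvar) (cst b10 * xvar + cst b01 * yvar) (0, 0) \<longleftrightarrow>
    b01 = - a10 \<and> a10 * b01 - a01 * b10 > 0"
proof -
  have "is_center (cst a10 * xvar + cst a01 * yvar) (cst b10 * xvar + cst b01 * yvar) (0, 0) \<longleftrightarrow>
    a01 * b10 \<noteq> 0 \<and> (a10 + b01)\<^sup>2 + 4 * (b10 * a01 - b01 * a10) < 0 \<and> a10 + b01 = 0"
    using fam_center_iff_even[of 0 a10 a01 b10 b01] by (simp add: famP_def famQ_def)
  \<comment> \<open>With zero trace the discriminant is -4 times the determinant, and its negativity
    already implies a01 b10 \<noteq> 0.\<close>
  also have "\<dots> \<longleftrightarrow> b01 = - a10 \<and> a10 * b01 - a01 * b10 > 0"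
    using fam_disc_imp[of 1 a10 b01 b10 a01] by (auto simp: algebra_simps)
  finally show ?thesis .
qed

lemma center_B3:
  "is_center (cst a20 * xvar^2 + cst a01 * yvar) (cst b30 * xvar^3 + cst b11 * xvar * yvar) (0, 0) \<longleftrightarrow>
    a01 * b30 \<noteq> 0 \<and> (2 * a20 + b11)^2 + 8 * (b30 * a01 - b11 * a20) < 0"
  using fam_center_iff_odd[of 1 a20 a01 b30 b11]
  by (simp add: famP_def famQ_def numeral_eq_Suc)

lemma center_C2:
  "is_center (cst a30 * xvar^3 + cst a01 * yvar) (cst b50 * xvar^5 + cst b21 * xvar^2 * yvar) (0, 0) \<longleftrightarrow>
    a01 * b50 \<noteq> 0 \<and> (3 * a30 + b21)^2 + 12 * (b50 * a01 - b21 * a30) < 0 \<and> 3 * a30 + b21 = 0"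
  using fam_center_iff_even[of 2 a30 a01 b50 b21] by (simp add: famP_def famQ_def)

lemma center_D6:
  "is_center (cst a40 * xvar^4 + cst a01 * yvar) (cst b70 * xvar^7 + cst b31 * xvar^3 * yvar) (0, 0) \<longleftrightarrow>
    a01 * b70 \<noteq> 0 \<and> (4 * a40 + b31)^2 + 16 * (b70 * a01 - b31 * a40) < 0"
  using fam_center_iff_odd[of 3 a40 a01 b70 b31] by (simp add: famP_def famQ_def)

lemma has_center_C8:
  assumes "\<mu> > - 1/3" "\<alpha> \<in> {1, -1}"
  shows "has_center (cst p1 * xvar^3 + cst (p2 - 3 * \<alpha> * \<mu>) * xvar^2 * yvar + cst p3 * xvar * yvar^2 - cst \<alpha> * yvar^3)
    (cst \<alpha> * xvar^3 + cst p1 * xvar^2 * yvar + cst (p2 + 3 * \<alpha> * \<mu>) * xvar * yvar^2 + cst p3 * yvar^3) \<longleftrightarrow> p3 = - p1"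
  using cubic_has_center_iff[OF assms, of p1 p2 p3] by (simp add: cubP_def cubQ_def)

lemma has_center_C9:
  assumes "\<alpha> \<in> {1, -1}"
  shows "has_center (cst p1 * xvar^3 + cst (p2 - \<alpha>) * xvar^2 * yvar + cst p3 * xvar * yvar^2 - cst \<alpha> * yvar^3)
    (cst \<alpha> * xvar^3 + cst p1 * xvar^2 * yvar + cst (p2 + \<alpha>) * xvar * yvar^2 + cst p3 * yvar^3) \<longleftrightarrow> p3 = - p1"
  using has_center_C8[of "1/3" \<alpha> p1 p2 p3] assms by simp

theorem theorem2:
  shows "
    (\<forall>a10 a01 b10 b01 :: real.
      let P = cst a10 * \<^bold>x + cst a01 * \<^bold>y;
          Q = cst b10 * \<^bold>x + cst b01 * \<^bold>y in
      coprime P Q \<longrightarrow>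
      (is_center P Q (0, 0) \<longleftrightarrow>
        b01 = - a10 \<and> a10 * b01 - a01 * b10 > 0)) \<and>
    (\<forall>p :: nat. \<forall>a10 bp0 b01 :: real.
      let P = cst a10 * \<^bold>x;
          Q = cst bp0 * \<^bold>x ^ p + cst b01 * \<^bold>y in
      p > 1 \<and> coprime P Q \<longrightarrow>
      \<not> has_center P Q) \<and>
    (\<forall>a20 a11 a02 b20 b11 b02 :: real.
      let P = cst a20 * \<^bold>x^2 + cst a11 * \<^bold>x * \<^bold>y + cst a02 * \<^bold>y^2;
          Q = cst b20 * \<^bold>x^2 + cst b11 * \<^bold>x * \<^bold>y + cst b02 * \<^bold>y^2 in
      coprime P Q \<longrightarrow>
      \<not> has_center P Q) \<and>
    (\<forall>a01 b20 :: real.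
      let P = cst a01 * \<^bold>y;
          Q = cst b20 * \<^bold>x^2 in
      coprime P Q \<longrightarrow>
      \<not> has_center P Q) \<and>
    (\<forall>a20 a01 b30 b11 :: real.
      let P = cst a20 * \<^bold>x^2 + cst a01 * \<^bold>y;
          Q = cst b30 * \<^bold>x^3 + cst b11 * \<^bold>x * \<^bold>y in
      coprime P Q \<longrightarrow>
      (is_center P Q (0, 0) \<longleftrightarrow>
        a01 * b30 \<noteq> 0 \<and>
        (2 * a20 + b11)^2 + 8 * (b30 * a01 - b11 * a20) < 0)) \<and>
    (\<forall>a30 a11 b40 b21 b02 :: real.
      let P = cst a30 * \<^bold>x^3 + cst a11 * \<^bold>x * \<^bold>y;
          Q = cst b40 * \<^bold>x^4 + cst b21 * \<^bold>x^2 * \<^bold>y + cst b02 * \<^bold>y^2 in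
      coprime P Q \<longrightarrow>
      \<not> has_center P Q) \<and>
    (\<forall>a30 a01 b50 b21 :: real.
      let P = cst a30 * \<^bold>x^3 + cst a01 * \<^bold>y;
          Q = cst b50 * \<^bold>x^5 + cst b21 * \<^bold>x^2 * \<^bold>y in
      coprime P Q \<longrightarrow>
      (is_center P Q (0, 0) \<longleftrightarrow>
        a01 * b50 \<noteq> 0 \<and>
        (3 * a30 + b21)^2 + 12 * (b50 * a01 - b21 * a30) < 0 \<and>
        3 * a30 + b21 = 0)) \<and>
    (\<forall>p1 p2 p3 \<mu> :: real.
      let P = cst p1 * \<^bold>x^3 + cst p2 * \<^bold>x^2 * \<^bold>y + cst p3 * \<^bold>x * \<^bold>y^2 + cst \<mu> * \<^bold>y^3;
          Q = cst \<mu> * \<^bold>x^3 + cst p1 * \<^bold>x^2 * \<^bold>y + cst p2 * \<^bold>x * \<^bold>y^2 + cst p3 * \<^bold>y^3 in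
      \<mu> \<noteq> 0 \<and> coprime P Q \<longrightarrow>
      \<not> has_center P Q) \<and>
    (\<forall>p1 p2 p3 :: real. \<forall>\<alpha>\<in>{1, -1}.
      let P = cst p1 * \<^bold>x^3 + cst (p2 + 3 * \<alpha>) * \<^bold>x^2 * \<^bold>y + cst (p3 - 6 * \<alpha>) * \<^bold>x * \<^bold>y^2 - cst (6 * \<alpha>) * \<^bold>y^3;
          Q = cst p1 * \<^bold>x^2 * \<^bold>y + cst (p2 - 3 * \<alpha>) * \<^bold>x * \<^bold>y^2 + cst (p3 + 6 * \<alpha>) * \<^bold>y^3 in
      coprime P Q \<longrightarrow>
      \<not> has_center P Q) \<and>
    (\<forall>p1 p2 p3 :: real.
      let P = cst p1 * \<^bold>x^3 + cst p2 * \<^bold>x^2 * \<^bold>y + cst (p3 + 2) * \<^bold>x * \<^bold>y^2 - cst 4 * \<^bold>y^3;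
          Q = cst p1 * \<^bold>x^2 * \<^bold>y + cst p2 * \<^bold>x * \<^bold>y^2 + cst (p3 - 2) * \<^bold>y^3 in
      coprime P Q \<longrightarrow>
      \<not> has_center P Q) \<and>
    (\<forall>p1 p2 p3 :: real. \<forall>\<alpha>\<in>{1, -1}.
      let P = cst p1 * \<^bold>x^3 + cst (p2 - 3 * \<alpha>) * \<^bold>x^2 * \<^bold>y + cst p3 * \<^bold>x * \<^bold>y^2 - cst 6 * \<^bold>y^3;
          Q = cst p1 * \<^bold>x^2 * \<^bold>y + cst (p2 + 3 * \<alpha>) * \<^bold>x * \<^bold>y^2 + cst p3 * \<^bold>y^3 in
      coprime P Q \<longrightarrow>
      \<not> has_center P Q) \<and>
    (\<forall>p1 p2 p3 :: real. \<forall>\<alpha>\<in>{1, -1}.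
      let P = cst p1 * \<^bold>x^3 + cst p2 * \<^bold>x^2 * \<^bold>y + cst p3 * \<^bold>x * \<^bold>y^2 - cst \<alpha> * \<^bold>y^3;
          Q = cst p1 * \<^bold>x^2 * \<^bold>y + cst p2 * \<^bold>x * \<^bold>y^2 + cst p3 * \<^bold>y^3 in
      coprime P Q \<longrightarrow>
      \<not> has_center P Q) \<and>
    (\<forall>p1 p2 p3 :: real.
      let P = \<^bold>x * (cst p1 * \<^bold>x^2 + cst p2 * \<^bold>x * \<^bold>y + cst p3 * \<^bold>y^2);
          Q = \<^bold>y * (cst p1 * \<^bold>x^2 + cst p2 * \<^bold>x * \<^bold>y + cst p3 * \<^bold>y^2) in
      \<not> has_center P Q) \<and>
    (\<forall>p1 p2 p3 \<mu> :: real. \<forall>\<alpha>\<in>{1, -1}.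
      let P = cst p1 * \<^bold>x^3 + cst (p2 - 3 * \<alpha> * \<mu>) * \<^bold>x^2 * \<^bold>y + cst p3 * \<^bold>x * \<^bold>y^2 - cst \<alpha> * \<^bold>y^3;
          Q = cst \<alpha> * \<^bold>x^3 + cst p1 * \<^bold>x^2 * \<^bold>y + cst (p2 + 3 * \<alpha> * \<mu>) * \<^bold>x * \<^bold>y^2 + cst p3 * \<^bold>y^3 in
      \<mu> > - 1/3 \<and> \<mu> \<noteq> 1/3 \<and> coprime P Q \<longrightarrow>
      (has_center P Q \<longleftrightarrow> p3 = - p1)) \<and>
    (\<forall>p1 p2 p3 :: real. \<forall>\<alpha>\<in>{1, -1}.
      let P = cst p1 * \<^bold>x^3 + cst (p2 - \<alpha>) * \<^bold>x^2 * \<^bold>y + cst p3 * \<^bold>x * \<^bold>y^2 - cst \<alpha> * \<^bold>y^3;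
          Q = cst \<alpha> * \<^bold>x^3 + cst p1 * \<^bold>x^2 * \<^bold>y + cst (p2 + \<alpha>) * \<^bold>x * \<^bold>y^2 + cst p3 * \<^bold>y^3 in
      coprime P Q \<longrightarrow>
      (has_center P Q \<longleftrightarrow> p3 = - p1)) \<and>
    (\<forall>a40 a31 a22 a13 a04 b40 b31 b22 b13 b04 :: real.
      let P = cst a40 * \<^bold>x^4 + cst a31 * \<^bold>x^3 * \<^bold>y + cst a22 * \<^bold>x^2 * \<^bold>y^2 + cst a13 * \<^bold>x * \<^bold>y^3 + cst a04 * \<^bold>y^4;
          Q = cst b40 * \<^bold>x^4 + cst b31 * \<^bold>x^3 * \<^bold>y + cst b22 * \<^bold>x^2 * \<^bold>y^2 + cst b13 * \<^bold>x * \<^bold>y^3 + cst b04 * \<^bold>y^4 in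
      coprime P Q \<longrightarrow>
      \<not> has_center P Q) \<and>
    (\<forall>a40 a21 a02 b50 b31 b12 :: real.
      let P = cst a40 * \<^bold>x^4 + cst a21 * \<^bold>x^2 * \<^bold>y + cst a02 * \<^bold>y^2;
          Q = cst b50 * \<^bold>x^5 + cst b31 * \<^bold>x^3 * \<^bold>y + cst b12 * \<^bold>x * \<^bold>y^2 in
      coprime P Q \<longrightarrow>
      \<not> has_center P Q) \<and>
    (\<forall>a40 a11 b60 b31 b02 :: real.
      let P = cst a40 * \<^bold>x^4 + cst a11 * \<^bold>x * \<^bold>y;
          Q = cst b60 * \<^bold>x^6 + cst b31 * \<^bold>x^3 * \<^bold>y + cst b02 * \<^bold>y^2 in
      coprime P Q \<longrightarrow>
      \<not> has_center P Q) \<and>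
    (\<forall>a11 b30 b02 :: real.
      let P = cst a11 * \<^bold>x * \<^bold>y;
          Q = cst b30 * \<^bold>x^3 + cst b02 * \<^bold>y^2 in
      coprime P Q \<longrightarrow>
      \<not> has_center P Q) \<and>
    (\<forall>a01 b40 :: real.
      let P = cst a01 * \<^bold>y;
          Q = cst b40 * \<^bold>x^4 in
      coprime P Q \<longrightarrow>
      \<not> has_center P Q) \<and>
    (\<forall>a40 a01 b70 b31 :: real.
      let P = cst a40 * \<^bold>x^4 + cst a01 * \<^bold>y;
          Q = cst b70 * \<^bold>x^7 + cst b31 * \<^bold>x^3 * \<^bold>y in
      coprime P Q \<longrightarrow>
      (is_center P Q (0, 0) \<longleftrightarrow>
        a01 * b70 \<noteq> 0 \<and>
        (4 * a40 + b31)^2 + 16 * (b70 * a01 - b31 * a40) < 0))"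
  unfolding Let_def
  by (intro conjI allI ballI impI center_A1 center_B3 center_C2 center_D6 has_center_C8 has_center_C9
      no_center_A2 no_center_B1 no_center_C1 no_center_D1 no_center_D2 no_center_D3 no_center_D4
      no_center_C3_to_C7_C10 no_center_even_force) auto

end
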